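(* Let $0<\lambda\le\Lambda$ with $\omega:=\Lambda/\lambda\ge4$. For every $\gamma\in\Gamma_\omega:=\left[\frac{2}{\sqrt\omega},\frac{\sqrt\omega}{2}\right]$, the function $u^\omega_\gamma$ is a positive eigenfunction of $-\mathcal M^+_{\lambda,\Lambda}$ in $\Omega^\omega_\gamma$ associated with the eigenvalue $\lambda$; that is, $u^\omega_\gamma>0$ in $\Omega^\omega_\gamma$, $u^\omega_\gamma=0$ on $\partial\Omega^\omega_\gamma$, and $-\mathcal M^+_{\lambda,\Lambda}(D^2u^\omega_\gamma)=\lambda u^\omega_\gamma$ in $\Omega^\omega_\gamma$ in the viscosity sense. In particular, $\mu_1^+(\Omega^\omega_\gamma)=\lambda$.
   Context: Pucci operator: for a symmetric $n\times n$ matrix $X$ with eigenvalues $e_1,\dots,e_n$, $\mathcal M^+_{\lambda,\Lambda}(X)=\Lambda\sum_{e_i>0}e_i+\lambda\sum_{e_i<0}e_i$. For a bounded domain $\Omega$, the principal positive half-eigenvalue is $\mu_1^+(\Omega)=\sup\{\mu\in\mathbb R:\exists\,\phi>0\text{ in }\Omega,\ \mathcal M^+_{\lambda,\Lambda}(D^2\phi)+\mu\phi\le 0\text{ in }\Omega\}$, where $\phi$ is continuous and the inequality is in the viscosity sense. The domains $\Omega^\omega_\gamma\subset\mathbb R^3$. Let $\alpha=\pi/2$. In the first octant $\{x,y,z\ge0\}$ define seven closed pieces: $[\mathrm C]=\{0\le x,y,z\le\alpha\}$; $[\mathrm Z]=\{0\le x,y\le\alpha,\ \alpha\le z\le\alpha+\sqrt\omega\arcsin(\frac{\gamma}{\sqrt\omega}(\cos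 x+\cos y))\}$; $[\mathrm X]=\{0\le y,z\le\alpha,\ \alpha\le x\le\alpha+\sqrt\omega\arcsin(\frac{\gamma\cos y+\cos z}{\gamma\sqrt\omega})\}$; $[\mathrm Y]=\{0\le x,z\le\alpha,\ \alpha\le y\le\alpha+\sqrt\omega\arcsin(\frac{\gamma\cos x+\cos z}{\gamma\sqrt\omega})\}$; $[\mathrm{ZX}]=\{\alpha\le x\le\alpha+\sqrt\omega\arcsin(\frac1{\sqrt\omega}),\ \alpha\le z\le\alpha+\sqrt\omega\arcsin(\frac{\gamma}{\sqrt\omega}),\ 0\le\theta\le1,\ 0\le y\le\arccos\theta\}$ with $\theta=\sqrt\omega\sin(\frac{x-\alpha}{\sqrt\omega})+\frac{\sqrt\omega}{\gamma}\sin(\frac{z-\alpha}{\sqrt\omega})$; $[\mathrm{XY}]=\{\alpha\le x,y\le\alpha+\sqrt\omega\arcsin(\frac1{\gamma\sqrt\omega}),\ 0\le\theta\le1,\ 0\le z\le\arccos\theta\}$ with $\theta=\gamma\sqrt\omega\sin(\frac{x-\alpha}{\sqrt\omega})+\gamma\sqrt\omega\sin(\frac{y-\alpha}{\sqrt\omega})$; $[\mathrm{YZ}]=\{\alpha\le y\le\alpha+\sqrt\omega\arcsin(\frac1{\sqrt\omega}),\ \alpha\le z\le\alpha+\sqrt\omega\arcsin(\frac{\gamma}{\sqrt\omega}),\ 0\le\theta\le1,\ 0\le x\le\arccos\theta\}$ with $\theta=\sqrt\omega\sin(\frac{y-\alpha}{\sqrt\omega})+\frac{\sqrt\omega}{\gamma}\sin(\frac{z-\alpha}{\sqrt\omega})$.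 (For $\gamma\in\Gamma_\omega$ all inverse trigonometric expressions, on principal branches, are well defined.) Let $K$ be the union of the seven pieces. $\Omega^\omega_\gamma$ is the interior of the reflected union $\{(\sigma_1x,\sigma_2y,\sigma_3z):(x,y,z)\in K,\ \sigma_i\in\{-1,1\}\}$. The function $u^{\omega,+}_\gamma$ on $K$ is defined piecewise by (using $\cos(t+\pi/2)=-\sin t$): on $[\mathrm C]$: $\gamma\cos x+\gamma\cos y+\cos z$; on $[\mathrm Z]$: $\gamma\cos x+\gamma\cos y-\sqrt\omega\sin(\frac{z-\alpha}{\sqrt\omega})$; on $[\mathrm X]$: $-\gamma\sqrt\omega\sin(\frac{x-\alpha}{\sqrt\omega})+\gamma\cos y+\cos z$; on $[\mathrm Y]$: $\gamma\cos x-\gamma\sqrt\omega\sin(\frac{y-\alpha}{\sqrt\omega})+\cos z$; on $[\mathrm{ZX}]$: $-\gamma\sqrt\omega\sin(\frac{x-\alpha}{\sqrt\omega})+\gamma\cos y-\sqrt\omega\sin(\frac{z-\alpha}{\sqrt\omega})$; on $[\mathrm{XY}]$: $-\gamma\sqrt\omega\sin(\frac{x-\alpha}{\sqrt\omega})-\gamma\sqrt\omega\sin(\frac{y-\alpha}{\sqrt\omega})+\cos z$; on $[\mathrm{YZ}]$: $\gamma\cos x-\gamma\sqrt\omega\sin(\frac{y-\alpha}{\sqrt\omega})-\sqrt\omega\sin(\frac{z-\alpha}{\sqrt\omega})$. The function $u^\omega_\gamma$ is its even extension across the three coordinate planes: $u^\omega_\gamma(x,y,z)=u^{\omega,+}_\gamma(|x|,|y|,|z|)$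 on $\overline{\Omega^\omega_\gamma}$. *)

theory Defs
  imports
    "HOL-Analysis.Analysis"
    "HOL-Computational_Algebra.Computational_Algebra"
begin

section \<open>The Pucci maximal operator\<close>

definition charpoly :: "real^'n^'n \<Rightarrow> real poly" where
  "charpoly X = det (mat [:0, 1:] - map_matrix (\<lambda>c. [:c:]) X)"

text \<open>The multiset of eigenvalues, with multiplicity.  Only real roots are collected, which are
  all of them for the symmetric matrices of interest.\<close>

definition eigenvalues :: "real^'n^'n \<Rightarrow> real multiset" where
  "eigenvalues X = proots (charpoly X)"

definition pucci_sup :: "real \<Rightarrow> real \<Rightarrow> real^'n^'n \<Rightarrow> real" where
  "pucci_sup lam Lam X =
     Lam * (\<Sum>e\<in>#filter_mset (\<lambda>e. e > 0) (eigenvalues X). e)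
   + lam * (\<Sum>e\<in>#filter_mset (\<lambda>e. e < 0) (eigenvalues X). e)"

section \<open>Viscosity solutions\<close>

text \<open>The function \<open>f\<close> is of class \<open>C\<^sup>2\<close> on the open set \<open>U\<close>, with gradient \<open>g\<close> and Hessian
  \<open>H\<close> there.  (Continuity of \<open>H\<close> makes it symmetric on \<open>U\<close>.)\<close>

definition C2_on ::
    "(real^'n) set \<Rightarrow> (real^'n \<Rightarrow> real) \<Rightarrow> (real^'n \<Rightarrow> real^'n) \<Rightarrow> (real^'n \<Rightarrow> real^'n^'n) \<Rightarrow> bool" where
  "C2_on U f g H \<longleftrightarrow>
     (\<forall>x\<in>U. (f has_derivative (\<lambda>h. g x \<bullet> h)) (at x)) \<and>
     (\<forall>x\<in>U. (g has_derivative (\<lambda>h. H x *v h)) (at x)) \<and>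
     continuous_on U H"

text \<open>Viscosity supersolution: \<open>M\<^sup>+(D\<^sup>2 u) + \<mu> u \<le> 0\<close> in \<open>\<Omega>\<close>, tested with \<open>C\<^sup>2\<close> functions \<open>\<psi>\<close>
  such that \<open>u - \<psi>\<close> has a local minimum (over the neighbourhood \<open>U\<close>) at \<open>x\<close>.\<close>

definition visc_super ::
    "real \<Rightarrow> real \<Rightarrow> real \<Rightarrow> (real^'n) set \<Rightarrow> (real^'n \<Rightarrow> real) \<Rightarrow> bool" where
  "visc_super lam Lam \<mu> \<Omega> u \<longleftrightarrow>
     continuous_on \<Omega> u \<and>
     (\<forall>U \<psi> g H. \<forall>x\<in>U. open U \<longrightarrow> U \<subseteq> \<Omega> \<longrightarrow> C2_on U \<psi> g H \<longrightarrow>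
        (\<forall>y\<in>U. u x - \<psi> x \<le> u y - \<psi> y) \<longrightarrow>
        pucci_sup lam Lam (H x) + \<mu> * u x \<le> 0)"

text \<open>Viscosity subsolution: \<open>M\<^sup>+(D\<^sup>2 u) + \<mu> u \<ge> 0\<close> in \<open>\<Omega>\<close>, with local maxima of \<open>u - \<psi>\<close>.\<close>

definition visc_sub ::
    "real \<Rightarrow> real \<Rightarrow> real \<Rightarrow> (real^'n) set \<Rightarrow> (real^'n \<Rightarrow> real) \<Rightarrow> bool" where
  "visc_sub lam Lam \<mu> \<Omega> u \<longleftrightarrow>
     continuous_on \<Omega> u \<and>
     (\<forall>U \<psi> g H. \<forall>x\<in>U. open U \<longrightarrow> U \<subseteq> \<Omega> \<longrightarrow> C2_on U \<psi> g H \<longrightarrow>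
        (\<forall>y\<in>U. u y - \<psi> y \<le> u x - \<psi> x) \<longrightarrow>
        pucci_sup lam Lam (H x) + \<mu> * u x \<ge> 0)"

definition positive_eigenfunction ::
    "real \<Rightarrow> real \<Rightarrow> real \<Rightarrow> (real^'n) set \<Rightarrow> (real^'n \<Rightarrow> real) \<Rightarrow> bool" where
  "positive_eigenfunction lam Lam \<mu> \<Omega> u \<longleftrightarrow>
     continuous_on (closure \<Omega>) u \<and>
     (\<forall>x\<in>\<Omega>. u x > 0) \<and>
     (\<forall>x\<in>frontier \<Omega>. u x = 0) \<and>
     visc_super lam Lam \<mu> \<Omega> u \<and> visc_sub lam Lam \<mu> \<Omega> u"

text \<open>The supremum is taken in the extended reals, so that its finiteness is part of any claim
  that it equals a given real number.\<close>

definition half_eigenvalue_pos :: "real \<Rightarrow> real \<Rightarrow> (real^'n) set \<Rightarrow> ereal" where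
  "half_eigenvalue_pos lam Lam \<Omega> =
     (SUP \<mu>\<in>{\<mu>. \<exists>\<phi>. (\<forall>x\<in>\<Omega>. \<phi> x > 0) \<and> visc_super lam Lam \<mu> \<Omega> \<phi>}. ereal \<mu>)"

section \<open>The domains\<close>

definition in_C :: "real \<Rightarrow> real \<Rightarrow> real \<Rightarrow> bool" where
  "in_C x y z \<longleftrightarrow> x \<in> {0..pi/2} \<and> y \<in> {0..pi/2} \<and> z \<in> {0..pi/2}"

definition in_Z :: "real \<Rightarrow> real \<Rightarrow> real \<Rightarrow> real \<Rightarrow> real \<Rightarrow> bool" where
  "in_Z \<omega> \<gamma> x y z \<longleftrightarrow> x \<in> {0..pi/2} \<and> y \<in> {0..pi/2} \<and>
     z \<in> {pi/2 .. pi/2 + sqrt \<omega> * arcsin (\<gamma> / sqrt \<omega> * (cos x + cos y))}"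

definition in_X :: "real \<Rightarrow> real \<Rightarrow> real \<Rightarrow> real \<Rightarrow> real \<Rightarrow> bool" where
  "in_X \<omega> \<gamma> x y z \<longleftrightarrow> y \<in> {0..pi/2} \<and> z \<in> {0..pi/2} \<and>
     x \<in> {pi/2 .. pi/2 + sqrt \<omega> * arcsin ((\<gamma> * cos y + cos z) / (\<gamma> * sqrt \<omega>))}"

definition in_Y :: "real \<Rightarrow> real \<Rightarrow> real \<Rightarrow> real \<Rightarrow> real \<Rightarrow> bool" where
  "in_Y \<omega> \<gamma> x y z \<longleftrightarrow> x \<in> {0..pi/2} \<and> z \<in> {0..pi/2} \<and>
     y \<in> {pi/2 .. pi/2 + sqrt \<omega> * arcsin ((\<gamma> * cos x + cos z) / (\<gamma> * sqrt \<omega>))}"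

definition in_ZX :: "real \<Rightarrow> real \<Rightarrow> real \<Rightarrow> real \<Rightarrow> real \<Rightarrow> bool" where
  "in_ZX \<omega> \<gamma> x y z \<longleftrightarrow>
     x \<in> {pi/2 .. pi/2 + sqrt \<omega> * arcsin (1 / sqrt \<omega>)} \<and>
     z \<in> {pi/2 .. pi/2 + sqrt \<omega> * arcsin (\<gamma> / sqrt \<omega>)} \<and>
     (let \<theta> = sqrt \<omega> * sin ((x - pi/2) / sqrt \<omega>) + sqrt \<omega> / \<gamma> * sin ((z - pi/2) / sqrt \<omega>)
      in \<theta> \<in> {0..1} \<and> y \<in> {0..arccos \<theta>})"

definition in_XY :: "real \<Rightarrow> real \<Rightarrow> real \<Rightarrow> real \<Rightarrow> real \<Rightarrow> bool" where
  "in_XY \<omega> \<gamma> x y z \<longleftrightarrow>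
     x \<in> {pi/2 .. pi/2 + sqrt \<omega> * arcsin (1 / (\<gamma> * sqrt \<omega>))} \<and>
     y \<in> {pi/2 .. pi/2 + sqrt \<omega> * arcsin (1 / (\<gamma> * sqrt \<omega>))} \<and>
     (let \<theta> = \<gamma> * sqrt \<omega> * sin ((x - pi/2) / sqrt \<omega>) + \<gamma> * sqrt \<omega> * sin ((y - pi/2) / sqrt \<omega>)
      in \<theta> \<in> {0..1} \<and> z \<in> {0..arccos \<theta>})"

definition in_YZ :: "real \<Rightarrow> real \<Rightarrow> real \<Rightarrow> real \<Rightarrow> real \<Rightarrow> bool" where
  "in_YZ \<omega> \<gamma> x y z \<longleftrightarrow>
     y \<in> {pi/2 .. pi/2 + sqrt \<omega> * arcsin (1 / sqrt \<omega>)} \<and>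
     z \<in> {pi/2 .. pi/2 + sqrt \<omega> * arcsin (\<gamma> / sqrt \<omega>)} \<and>
     (let \<theta> = sqrt \<omega> * sin ((y - pi/2) / sqrt \<omega>) + sqrt \<omega> / \<gamma> * sin ((z - pi/2) / sqrt \<omega>)
      in \<theta> \<in> {0..1} \<and> x \<in> {0..arccos \<theta>})"

definition K_set :: "real \<Rightarrow> real \<Rightarrow> (real^3) set" where
  "K_set \<omega> \<gamma> = {p. let x = p$1; y = p$2; z = p$3 in
     in_C x y z \<or> in_Z \<omega> \<gamma> x y z \<or> in_X \<omega> \<gamma> x y z \<or> in_Y \<omega> \<gamma> x y z \<or>
     in_ZX \<omega> \<gamma> x y z \<or> in_XY \<omega> \<gamma> x y z \<or> in_YZ \<omega> \<gamma> x y z}"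

definition Omega :: "real \<Rightarrow> real \<Rightarrow> (real^3) set" where
  "Omega \<omega> \<gamma> = interior {(\<chi> i. \<sigma> $ i * q $ i) | q \<sigma>. q \<in> K_set \<omega> \<gamma> \<and> (\<forall>i. \<sigma> $ i \<in> {-1, 1})}"

section \<open>The eigenfunction\<close>

text \<open>Two pieces meet only where the coordinates that distinguish them equal \<open>\<pi>/2\<close>.  There
  \<open>cos t\<close> and \<open>- sqrt \<omega> * sin ((t - \<pi>/2) / sqrt \<omega>)\<close> both vanish, so the formulas agree on
  overlaps and the order of the cases is immaterial.  The final value 0 is only taken outside
  the union of the pieces.\<close>

definition u_pos :: "real \<Rightarrow> real \<Rightarrow> real \<Rightarrow> real \<Rightarrow> real \<Rightarrow> real" where
  "u_pos \<omega> \<gamma> x y z =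
    (if in_C x y z then
       \<gamma> * cos x + \<gamma> * cos y + cos z
     else if in_Z \<omega> \<gamma> x y z then
       \<gamma> * cos x + \<gamma> * cos y - sqrt \<omega> * sin ((z - pi/2) / sqrt \<omega>)
     else if in_X \<omega> \<gamma> x y z then
       - \<gamma> * sqrt \<omega> * sin ((x - pi/2) / sqrt \<omega>) + \<gamma> * cos y + cos z
     else if in_Y \<omega> \<gamma> x y z then
       \<gamma> * cos x - \<gamma> * sqrt \<omega> * sin ((y - pi/2) / sqrt \<omega>) + cos z
     else if in_ZX \<omega> \<gamma> x y z then
       - \<gamma> * sqrt \<omega> * sin ((x - pi/2) / sqrt \<omega>) + \<gamma> * cos y - sqrt \<omega> * sin ((z - pi/2) / sqrt \<omega>)
     else if in_XY \<omega> \<gamma> x y z then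
       - \<gamma> * sqrt \<omega> * sin ((x - pi/2) / sqrt \<omega>) - \<gamma> * sqrt \<omega> * sin ((y - pi/2) / sqrt \<omega>) + cos z
     else if in_YZ \<omega> \<gamma> x y z then
       \<gamma> * cos x - \<gamma> * sqrt \<omega> * sin ((y - pi/2) / sqrt \<omega>) - sqrt \<omega> * sin ((z - pi/2) / sqrt \<omega>)
     else 0)"

definition u_fun :: "real \<Rightarrow> real \<Rightarrow> real^3 \<Rightarrow> real" where
  "u_fun \<omega> \<gamma> p = u_pos \<omega> \<gamma> \<bar>p$1\<bar> \<bar>p$2\<bar> \<bar>p$3\<bar>"

end

theory Submission
  imports Defs
begin

no_notation fps_nth (infixl "$" 75)

text \<open>The function \<open>u\<close> is \<open>\<gamma> f(x) + \<gamma> f(y) + f(z)\<close> for one even profile \<open>f\<close> that is a cosine up to \<open>\<pi>/2\<close>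
  and a stretched sine beyond it.  The stretching makes \<open>f\<close> of class \<open>C\<^sup>2\<close> on the whole line, and
  Pucci's weights turn \<open>f''\<close> into \<open>-\<lambda>f\<close> on both parts; hence u is a classical solution, and
  the domain is just the set where \<open>u\<close> is positive and all coordinates are below the minimum \<open>T\<close>
  of \<open>f\<close>.  Monotonicity of the Pucci operator makes \<open>u\<close> a viscosity solution.

  For the upper bound on the half-eigenvalue, suppose \<open>\<phi> > 0\<close> is a supersolution for some \<open>\<mu> > \<lambda>\<close>.
  No boundary behaviour of \<open>\<phi>\<close> is known, so it is touched from below by a multiple of
  \<open>u^r - \<epsilon>\<close>, which is positive only on a compact part of the domain.  With \<open>1 < r < \<mu>/\<lambda>\<close> this is a
  strict subsolution: away from the boundary because \<open>\<mu> > \<lambda>r\<close>, and near it because of the term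
  \<open>\<lambda>r(r-1)u^(r-2)|\<nabla>u|\<^sup>2\<close> and the estimate \<open>|\<nabla>u|\<^sup>2 \<ge> \<kappa>u\<close>.  The latter survives at boundary points
  where the gradient vanishes, such as \<open>(0, 0, T)\<close> for \<open>\<gamma> = \<surd>\<omega>/2\<close>.\<close>

section \<open>Spectral theorem and bounds for the Pucci operator\<close>

lemma dot_matrix_symmetric:
  fixes X :: "real^'n^'n"
  assumes "transpose X = X"
  shows "x \<bullet> (X *v y) = (X *v x) \<bullet> y"
  using assms by (metis dot_lmul_matrix vector_transpose_matrix)

text \<open>A maximiser \<open>v\<close> of the quadratic form on the unit sphere of
  \<open>V\<close> is an eigenvector: by invariance the residual
  \<open>X *v v - e *\<^sub>R v\<close> is itself an admissible direction in \<open>V\<close>, and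
  the first variation along it must vanish.\<close>

lemma symmetric_matrix_eigenvector:
  fixes X :: "real^'n^'n"
  assumes sym: "transpose X = X" and V: "subspace V" and inv: "\<And>v. v \<in> V \<Longrightarrow> X *v v \<in> V"
    and nz: "V \<noteq> {0}"
  obtains v e where "v \<in> V" "norm v = 1" "X *v v = e *\<^sub>R v"
proof -
  let ?S = "V \<inter> sphere 0 1"
  obtain w where w: "w \<in> V" "w \<noteq> 0"
    using nz subspace_0[OF V] by blast
  have "(1 / norm w) *\<^sub>R w \<in> ?S"
    using w V by (auto simp: subspace_scale)
  then have "?S \<noteq> {}" by blast
  moreover have "compact ?S"
    using closed_subspace[OF V] by (simp add: closed_Int_compact)
  moreover have "continuous_on ?S (\<lambda>v. v \<bullet> (X *v v))"
    by (intro continuous_intros)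
  ultimately obtain v where v: "v \<in> ?S" and max: "\<And>y. y \<in> ?S \<Longrightarrow> y \<bullet> (X *v y) \<le> v \<bullet> (X *v v)"
    using continuous_attains_sup[of ?S "\<lambda>v. v \<bullet> (X *v v)"] by blast
  define e where "e = v \<bullet> (X *v v)"
  have vv: "v \<bullet> v = 1" using v by (simp add: norm_eq_1)
  have le: "y \<bullet> (X *v y) \<le> e * (y \<bullet> y)" if "y \<in> V" for y
  proof (cases "y = 0")
    case False
    define z where "z = (1 / norm y) *\<^sub>R y"
    have "z \<in> ?S" using that V False by (auto simp: subspace_scale z_def)
    from max[OF this] have "z \<bullet> (X *v z) \<le> e" by (simp add: e_def)
    moreover have "z \<bullet> (X *v z) = (y \<bullet> (X *v y)) / (norm y)\<^sup>2"
      by (simp add: z_def matrix_vector_mult_scaleR power2_eq_square)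
    ultimately show ?thesis
      using False by (simp add: divide_simps dot_square_norm)
  qed simp
  define h where "h = X *v v - e *\<^sub>R v"
  have hV: "h \<in> V" unfolding h_def using v V inv by (auto intro!: subspace_diff subspace_scale)
  \<comment> \<open>\<open>le\<close> at \<open>v + t *\<^sub>R h\<close> expands to 2t|h|^2 <= t^2
    C; dividing by t and letting t tend to 0 from the right forces \<open>h = 0\<close>.\<close>
  define C where "C = e * (h \<bullet> h) - h \<bullet> (X *v h)"
  have "2 * (h \<bullet> h) \<le> t * C" if "t > 0" for t :: real
  proof -
    have "v + t *\<^sub>R h \<in> V" using v hV V by (auto intro!: subspace_add subspace_scale)
    from le[OF this] have "v \<bullet> (X *v v) + t * (v \<bullet> (X *v h)) + t * (h \<bullet> (X *v v)) + t * t * (h \<bullet> (X *v h))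
       \<le> e * (v \<bullet> v + 2 * t * (h \<bullet> v) + t * t * (h \<bullet> h))"
      by (simp add: matrix_vector_right_distrib matrix_vector_mult_scaleR inner_add_left
          inner_add_right inner_commute[of v h] algebra_simps)
    moreover have "v \<bullet> (X *v h) = h \<bullet> (X *v v)"
      by (simp only: dot_matrix_symmetric[OF sym, of v h] inner_commute)
    moreover have "h \<bullet> (X *v v - e *\<^sub>R v) = h \<bullet> (X *v v) - e * (h \<bullet> v)"
      by (simp add: inner_diff_right)
    then have "h \<bullet> (X *v v) = h \<bullet> h + e * (h \<bullet> v)" unfolding h_def[symmetric] by linarith
    ultimately have "e + t * (h \<bullet> h + e * (h \<bullet> v)) + t * (h \<bullet> h + e * (h \<bullet> v)) + t * t * (h \<bullet> (X *v h))
       \<le> e * (1 + 2 * t * (h \<bullet> v) + t * t * (h \<bullet> h))"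
      by (simp only: vv e_def[symmetric])
    then have "t * (2 * (h \<bullet> h)) \<le> t * (t * C)"
      by (simp add: C_def algebra_simps)
    then show ?thesis using that by simp
  qed
  then have *: "2 * (h \<bullet> h) \<le> t * C" if "t > 0" for t using that by blast
  have "((\<lambda>t. t * C) \<longlongrightarrow> 0 * C) (at_right 0)" by (intro tendsto_intros)
  moreover have "\<forall>\<^sub>F t in at_right 0. 2 * (h \<bullet> h) \<le> t * C"
    by (rule eventually_at_rightI[of 0 1]) (auto intro: *)
  ultimately have "2 * (h \<bullet> h) \<le> 0 * C"
    by (intro tendsto_lowerbound[where F = "at_right (0::real)"]) auto
  then have "h \<bullet> h = 0" using inner_ge_zero[of h] by linarith
  then have "h = 0" by simp
  then show ?thesis
    using that[of v e] v by (auto simp: h_def)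
qed

text \<open>Induction on the dimension: by symmetry the orthogonal complement in \<open>V\<close> of
  a unit eigenvector is again invariant, and it is strictly smaller.\<close>

lemma symmetric_matrix_orthonormal_eigenvectors:
  fixes X :: "real^'n^'n"
  assumes sym: "transpose X = X" and V: "subspace V" and inv: "\<And>v. v \<in> V \<Longrightarrow> X *v v \<in> V"
  shows "\<exists>B \<subseteq> V. pairwise orthogonal B \<and> span B = V \<and> (\<forall>b\<in>B. norm b = 1 \<and> (\<exists>e. X *v b = e *\<^sub>R b))"
  using V inv
proof (induction "dim V" arbitrary: V rule: less_induct)
  case less
  show ?case
  proof (cases "V = {0}")
    case True
    then show ?thesis by (intro exI[of _ "{}"]) auto
  next
    case False
    obtain v e where v: "v \<in> V" "norm v = 1" "X *v v = e *\<^sub>R v"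
      using symmetric_matrix_eigenvector[OF sym less(2,3) False] by metis
    have vv: "v \<bullet> v = 1" using v by (simp add: norm_eq_1)
    define W where "W = {x \<in> V. x \<bullet> v = 0}"
    have W: "subspace W"
      using less(2) by (auto simp: W_def subspace_def inner_add_left)
    have invW: "X *v x \<in> W" if "x \<in> W" for x
      using that less(3) v by (auto simp: W_def dot_matrix_symmetric[OF sym, symmetric])
    have "v \<notin> W" using vv by (simp add: W_def)
    moreover have "W \<subseteq> V" by (auto simp: W_def)
    ultimately have "W \<subset> V" using v by blast
    then have "span W \<subset> span V"
      by (metis W less(2) span_eq_iff)
    then have "dim W < dim V" by (rule dim_psubset)
    from less(1)[OF this W invW] obtain B where B: "B \<subseteq> W" "pairwise orthogonal B" "span B = W"
      "\<forall>b\<in>B. norm b = 1 \<and> (\<exists>e. X *v b = e *\<^sub>R b)" by auto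
    have "span (insert v B) = V"
    proof
      show "span (insert v B) \<subseteq> V"
        using B(1) v(1) less(2) by (intro span_minimal) (auto simp: W_def)
      show "V \<subseteq> span (insert v B)"
      proof
        fix x assume x: "x \<in> V"
        have "x - (x \<bullet> v) *\<^sub>R v \<in> W"
          using x v(1) vv less(2) by (auto simp: W_def inner_diff_left intro!: subspace_diff subspace_scale)
        then show "x \<in> span (insert v B)"
          using B(3) by (auto simp: span_insert)
      qed
    qed
    moreover have "pairwise orthogonal (insert v B)"
      using B(1,2) by (auto simp: pairwise_insert orthogonal_def W_def inner_commute)
    moreover have "insert v B \<subseteq> V" using B v by (auto simp: W_def)
    moreover have "\<forall>b\<in>insert v B. norm b = 1 \<and> (\<exists>e. X *v b = e *\<^sub>R b)"
      using v(2,3) B(4) by blast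
    ultimately show ?thesis by (intro exI[of _ "insert v B"] conjI)
  qed
qed

theorem spectral_theorem_symmetric_matrix:
  fixes X :: "real^'n^'n"
  assumes sym: "transpose X = X"
  obtains Q :: "real^'n^'n" and e :: "'n \<Rightarrow> real"
  where "orthogonal_matrix Q" "X ** Q = Q ** (\<chi> i j. if i = j then e i else 0)"
proof -
  obtain B where B: "pairwise orthogonal B" "span B = UNIV"
    "\<And>b. b \<in> B \<Longrightarrow> norm b = 1 \<and> (\<exists>e. X *v b = e *\<^sub>R b)"
    using symmetric_matrix_orthonormal_eigenvectors[OF sym, of UNIV] by auto
  have "0 \<notin> B" using B(3) by force
  then have ind: "independent B" using B(1) pairwise_orthogonal_independent by blast
  then have fin: "finite B" using independent_bound by blast
  \<comment> \<open>An eigenbasis has as many members as there are coordinates, so it can be indexed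
    by \<open>'n\<close> and written as the columns of a square matrix.\<close>
  have "card B = CARD('n)"
    using ind B(2) dim_eq_card_independent[of B] dim_span[of B] by simp
  then obtain q :: "'n \<Rightarrow> real^'n" where q: "bij_betw q UNIV B"
    using finite_same_card_bij[OF finite_class.finite_UNIV fin] by metis
  have qB: "q k \<in> B" for k using q by (auto simp: bij_betw_def)
  have "\<forall>k. \<exists>e. X *v q k = e *\<^sub>R q k" using B(3) qB by blast
  then obtain e where e: "\<And>k. X *v q k = e k *\<^sub>R q k" by metis
  define Q :: "real^'n^'n" where "Q = (\<chi> i k. q k $ i)"
  have ort: "q k \<bullet> q l = (if k = l then 1 else 0)" for k l
  proof (cases "k = l")
    case True
    then show ?thesis using B(3)[OF qB] by (simp add: norm_eq_1)
  next
    case False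
    then have "q k \<noteq> q l" using q by (auto simp: bij_betw_def inj_on_def)
    then show ?thesis using B(1) qB False by (auto simp: pairwise_def orthogonal_def)
  qed
  have "transpose Q ** Q = mat 1"
    by (simp add: Q_def transpose_def matrix_matrix_mult_def mat_def vec_eq_iff
        ort[unfolded inner_vec_def, simplified])
  then have 1: "orthogonal_matrix Q"
    by (simp add: orthogonal_matrix)
  have 2: "X ** Q = Q ** (\<chi> i j. if i = j then e i else 0)"
  proof -
    have "(X ** Q) $ i $ k = (Q ** (\<chi> i j. if i = j then e i else 0)) $ i $ k" for i k
    proof -
      have "(X ** Q) $ i $ k = (X *v q k) $ i"
        by (simp add: Q_def matrix_matrix_mult_def matrix_vector_mult_def)
      also have "\<dots> = Q $ i $ k * e k"
        unfolding e by (simp add: Q_def)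
      also have "\<dots> = (Q ** (\<chi> i j. if i = j then e i else 0)) $ i $ k"
        by (simp add: matrix_matrix_mult_def if_distrib cong: if_cong)
      finally show ?thesis .
    qed
    then show ?thesis by (simp add: vec_eq_iff)
  qed
  from that[OF 1 2] show ?thesis .
qed

section \<open>Characteristic polynomial and eigenvalues of a diagonalised matrix\<close>

lemma sum_const_poly: "(\<Sum>i\<in>A. [:f i:]) = [:\<Sum>i\<in>A. f i:]"
  by (induction A rule: infinite_finite_induct) auto

lemma map_matrix_const_poly_mult:
  fixes A :: "real^'n^'m" and B :: "real^'k^'n"
  shows "map_matrix (\<lambda>c. [:c:]) (A ** B) = map_matrix (\<lambda>c. [:c:]) A ** map_matrix (\<lambda>c. [:c:]) B"
  by (simp add: vec_eq_iff matrix_matrix_mult_def sum_const_poly[symmetric] mult.commute)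

lemma mat_commute:
  fixes A :: "'a::comm_semiring_1^'n^'n"
  shows "mat c ** A = A ** mat c"
  by (simp add: vec_eq_iff matrix_matrix_mult_def mat_def if_distrib if_distribR mult.commute
      cong: if_cong)

lemma matrix_mult_diff_distrib:
  fixes A B :: "'a::ring_1^'n^'m"
  shows "(A - B) ** C = A ** C - B ** C" "D ** (A - B) = D ** A - D ** B"
  by (simp_all add: vec_eq_iff matrix_matrix_mult_def left_diff_distrib right_diff_distrib sum_subtractf)

text \<open>The determinant is taken over the polynomial ring, so \<open>Q\<close> is lifted to
  constant polynomials. The lifted determinant is a divisor of 1, hence nonzero, and cancels from
  both sides of the intertwining relation.\<close>

lemma charpoly_of_diagonalisation:
  fixes X Q :: "real^'n^'n" and e :: "'n \<Rightarrow> real"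
  assumes "orthogonal_matrix Q" "X ** Q = Q ** (\<chi> i j. if i = j then e i else 0)"
  shows "charpoly X = (\<Prod>k\<in>UNIV. [:- e k, 1:])"
proof -
  let ?P = "map_matrix (\<lambda>c::real. [:c:])"
  let ?D = "(\<chi> i j. if i = j then e i else 0) :: real^'n^'n"
  have "?P (transpose Q) ** ?P Q = mat 1"
    using assms(1) by (auto simp: map_matrix_const_poly_mult[symmetric] orthogonal_matrix_def
        vec_eq_iff mat_def)
  from arg_cong[OF this, of det]
  have "det (?P (transpose Q)) * det (?P Q) = 1"
    unfolding det_mul det_I .
  then have nz: "det (?P Q) \<noteq> 0" by auto
  have "?P X ** ?P Q = ?P Q ** ?P ?D"
    by (simp only: map_matrix_const_poly_mult[symmetric] assms(2))
  then have "(mat [:0, 1:] - ?P X) ** ?P Q = ?P Q ** (mat [:0, 1:] - ?P ?D)"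
    unfolding matrix_mult_diff_distrib mat_commute[of "[:0, 1:]" "?P Q"] by (rule arg_cong)
  from arg_cong[OF this, of det]
  have "charpoly X * det (?P Q) = det (?P Q) * det (mat [:0, 1:] - ?P ?D)"
    unfolding charpoly_def det_mul .
  then have "charpoly X = det (mat [:0, 1:] - ?P ?D)" using nz by simp
  also have "\<dots> = (\<Prod>k\<in>UNIV. (mat [:0, 1:] - ?P ?D) $ k $ k)"
    by (rule det_diagonal) (simp add: mat_def)
  also have "\<dots> = (\<Prod>k\<in>UNIV. [:- e k, 1:])"
    by (simp add: mat_def)
  finally show ?thesis .
qed

lemma eigenvalues_of_diagonalisation:
  fixes X Q :: "real^'n^'n" and e :: "'n \<Rightarrow> real"
  assumes "orthogonal_matrix Q" "X ** Q = Q ** (\<chi> i j. if i = j then e i else 0)"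
  shows "eigenvalues X = image_mset e (mset_set UNIV)"
proof -
  have "eigenvalues X = (\<Sum>k\<in>UNIV. {#e k#})"
    unfolding eigenvalues_def charpoly_of_diagonalisation[OF assms]
    by (subst proots_prod) auto
  also have "\<dots> = image_mset e (mset_set UNIV)"
    by (induction "UNIV :: 'n set" rule: infinite_finite_induct) (auto simp: sum_unfold_sum_mset)
  finally show ?thesis .
qed

lemma sum_mset_filter_image_mset_set:
  fixes e :: "'a \<Rightarrow> real"
  assumes "finite A"
  shows "(\<Sum>x\<in>#filter_mset P (image_mset e (mset_set A)). x) = (\<Sum>k\<in>A. if P (e k) then e k else 0)"
  using assms by (induction A rule: finite_induct) auto

lemma pucci_sup_of_diagonalisation:
  fixes X Q :: "real^'n^'n" and e :: "'n \<Rightarrow> real"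
  assumes "orthogonal_matrix Q" "X ** Q = Q ** (\<chi> i j. if i = j then e i else 0)"
  shows "pucci_sup lam Lam X = (\<Sum>k\<in>UNIV. (if e k > 0 then Lam else lam) * e k)"
proof -
  have "(if x > 0 then Lam else lam) * x = Lam * (if x > 0 then x else 0) + lam * (if x < 0 then x else 0)" for x :: real
    by simp
  then have "(\<Sum>k\<in>UNIV. (if e k > 0 then Lam else lam) * e k) =
     (\<Sum>k\<in>UNIV. Lam * (if e k > 0 then e k else 0) + lam * (if e k < 0 then e k else 0))"
    by (intro sum.cong refl)
  also have "\<dots> = pucci_sup lam Lam X"
    unfolding pucci_sup_def eigenvalues_of_diagonalisation[OF assms]
      sum_mset_filter_image_mset_set[OF finite] sum_distrib_left sum.distrib ..
  finally show ?thesis ..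
qed

lemma diagonalisation_diag_entry:
  fixes X Q :: "real^'n^'n" and e :: "'n \<Rightarrow> real"
  assumes "orthogonal_matrix Q" "X ** Q = Q ** (\<chi> i j. if i = j then e i else 0)"
  shows "X $ i $ i = (\<Sum>k\<in>UNIV. e k * (Q $ i $ k)\<^sup>2)"
proof -
  let ?D = "(\<chi> i j. if i = j then e i else 0) :: real^'n^'n"
  have D: "(Q ** ?D) $ i $ k = Q $ i $ k * e k" for i k
    by (simp add: matrix_matrix_mult_def if_distrib cong: if_cong)
  have "X = (Q ** ?D) ** transpose Q"
    unfolding assms(2)[symmetric] matrix_mul_assoc[symmetric]
    using assms(1) by (simp add: orthogonal_matrix_def)
  then have "X $ i $ i = ((Q ** ?D) ** transpose Q) $ i $ i" by (rule arg_cong)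
  also have "\<dots> = (\<Sum>k\<in>UNIV. (Q ** ?D) $ i $ k * transpose Q $ k $ i)"
    unfolding matrix_matrix_mult_def[of "Q ** ?D"] by (simp only: vec_lambda_beta)
  also have "\<dots> = (\<Sum>k\<in>UNIV. (Q ** ?D) $ i $ k * Q $ i $ k)"
    by (simp only: transpose_def vec_lambda_beta)
  also have "\<dots> = (\<Sum>k\<in>UNIV. e k * (Q $ i $ k)\<^sup>2)"
    unfolding D by (simp add: power2_eq_square mult_ac)
  finally show ?thesis .
qed

text \<open>The squared entries form a doubly stochastic matrix. Its rows and columns serve as
  averaging weights when eigenvalues are traded for diagonal entries.\<close>

lemma orthogonal_matrix_sum_squares:
  fixes Q :: "real^'n^'n"
  assumes "orthogonal_matrix Q"
  shows "(\<Sum>k\<in>UNIV. (Q $ i $ k)\<^sup>2) = 1" "(\<Sum>i\<in>UNIV. (Q $ i $ k)\<^sup>2) = 1"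
proof -
  have "(\<Sum>k\<in>UNIV. (Q $ i $ k)\<^sup>2) = (Q ** transpose Q) $ i $ i"
    by (simp add: matrix_matrix_mult_def transpose_def power2_eq_square)
  also have "\<dots> = 1"
    using assms by (simp add: orthogonal_matrix_def mat_def)
  finally show "(\<Sum>k\<in>UNIV. (Q $ i $ k)\<^sup>2) = 1" .
  have "(\<Sum>i\<in>UNIV. (Q $ i $ k)\<^sup>2) = (transpose Q ** Q) $ k $ k"
    by (simp add: matrix_matrix_mult_def transpose_def power2_eq_square)
  also have "\<dots> = 1"
    using assms by (simp add: orthogonal_matrix_def mat_def)
  finally show "(\<Sum>i\<in>UNIV. (Q $ i $ k)\<^sup>2) = 1" .
qed

section \<open>Extremality of the Pucci weights\<close>

lemma weight_mult_le:
  fixes lam Lam a d :: real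
  assumes "lam \<le> a" "a \<le> Lam"
  shows "a * d \<le> (if d > 0 then Lam else lam) * d"
  using assms by (simp add: mult_right_mono mult_right_mono_neg)

text \<open>One half of the formula M^+(X) = sup tr(AX), for diagonal \<open>A\<close>. In the
  eigenbasis the trace gives each \<open>e k\<close> a weight that is an average of the
  \<open>A i\<close>; this weight lies in [\<open>lam\<close>, \<open>Lam\<close>], where Pucci's
  choice by sign is the largest.\<close>

lemma pucci_sup_ge_weighted_diag:
  fixes X :: "real^'n^'n"
  assumes sym: "transpose X = X" and A: "\<And>i. lam \<le> A i \<and> A i \<le> Lam"
  shows "(\<Sum>i\<in>UNIV. A i * X $ i $ i) \<le> pucci_sup lam Lam X"
proof -
  obtain Q :: "real^'n^'n" and e where Q: "orthogonal_matrix Q"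
    and X: "X ** Q = Q ** (\<chi> i j. if i = j then e i else 0)"
    by (rule spectral_theorem_symmetric_matrix[OF sym])
  note ss = orthogonal_matrix_sum_squares[OF Q]
  have "(\<Sum>i\<in>UNIV. A i * X $ i $ i) = (\<Sum>k\<in>UNIV. (\<Sum>i\<in>UNIV. A i * (Q $ i $ k)\<^sup>2) * e k)"
    unfolding diagonalisation_diag_entry[OF Q X] sum_distrib_left sum_distrib_right
    by (subst sum.swap) (simp add: mult_ac)
  also have "\<dots> \<le> (\<Sum>k\<in>UNIV. (if e k > 0 then Lam else lam) * e k)"
  proof (intro sum_mono weight_mult_le)
    fix k
    have "lam = (\<Sum>i\<in>UNIV. lam * (Q $ i $ k)\<^sup>2)" by (simp add: ss sum_distrib_left[symmetric])
    also have "\<dots> \<le> (\<Sum>i\<in>UNIV. A i * (Q $ i $ k)\<^sup>2)" using A by (intro sum_mono mult_right_mono) auto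
    finally show "lam \<le> (\<Sum>i\<in>UNIV. A i * (Q $ i $ k)\<^sup>2)" .
    have "(\<Sum>i\<in>UNIV. A i * (Q $ i $ k)\<^sup>2) \<le> (\<Sum>i\<in>UNIV. Lam * (Q $ i $ k)\<^sup>2)"
      using A by (intro sum_mono mult_right_mono) auto
    also have "\<dots> = Lam" by (simp add: ss sum_distrib_left[symmetric])
    finally show "(\<Sum>i\<in>UNIV. A i * (Q $ i $ k)\<^sup>2) \<le> Lam" .
  qed
  also have "\<dots> = pucci_sup lam Lam X" by (simp add: pucci_sup_of_diagonalisation[OF Q X])
  finally show ?thesis .
qed

text \<open>Monotonicity of the Pucci operator against a diagonal matrix, whose Pucci value is the
  right-hand side. Unit eigenvectors bound each eigenvalue by an average of the \<open>d i\<close>;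
  exchanging the sums turns the nonnegative weights \<open>c k\<close> into averages attached to
  each \<open>d i\<close>, again within [\<open>lam\<close>, \<open>Lam\<close>].\<close>

lemma pucci_sup_le_diagonal:
  fixes X :: "real^'n^'n" and d :: "'n \<Rightarrow> real"
  assumes sym: "transpose X = X" and lam: "0 \<le> lam" "lam \<le> Lam"
    and le: "\<And>v. v \<bullet> (X *v v) \<le> (\<Sum>i\<in>UNIV. d i * (v $ i)\<^sup>2)"
  shows "pucci_sup lam Lam X \<le> (\<Sum>i\<in>UNIV. (if d i > 0 then Lam else lam) * d i)"
proof -
  obtain Q :: "real^'n^'n" and e where Q: "orthogonal_matrix Q"
    and X: "X ** Q = Q ** (\<chi> i j. if i = j then e i else 0)"
    by (rule spectral_theorem_symmetric_matrix[OF sym])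
  note ss = orthogonal_matrix_sum_squares[OF Q]
  define c where "c k = (if e k > 0 then Lam else lam)" for k
  have c: "lam \<le> c k" "c k \<le> Lam" "0 \<le> c k" for k using lam by (auto simp: c_def)
  have e_le: "e k \<le> (\<Sum>i\<in>UNIV. d i * (Q $ i $ k)\<^sup>2)" for k
  proof -
    let ?q = "column k Q"
    have "X *v ?q = column k (X ** Q)"
      by (simp add: column_def matrix_vector_mult_def matrix_matrix_mult_def)
    also have "\<dots> = e k *\<^sub>R ?q"
      unfolding X by (simp add: column_def vec_eq_iff matrix_matrix_mult_def if_distrib mult.commute cong: if_cong)
    finally have "?q \<bullet> (X *v ?q) = e k * (?q \<bullet> ?q)" by simp
    also have "?q \<bullet> ?q = 1"
      using ss(2)[of k] by (simp add: inner_vec_def column_def power2_eq_square)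
    finally show ?thesis using le[of ?q] by (simp add: column_def)
  qed
  have "pucci_sup lam Lam X = (\<Sum>k\<in>UNIV. c k * e k)"
    by (simp add: pucci_sup_of_diagonalisation[OF Q X] c_def)
  also have "\<dots> \<le> (\<Sum>k\<in>UNIV. c k * (\<Sum>i\<in>UNIV. d i * (Q $ i $ k)\<^sup>2))"
    using e_le c by (intro sum_mono mult_left_mono) auto
  also have "\<dots> = (\<Sum>i\<in>UNIV. (\<Sum>k\<in>UNIV. c k * (Q $ i $ k)\<^sup>2) * d i)"
    unfolding sum_distrib_left sum_distrib_right by (subst sum.swap) (simp add: mult_ac)
  also have "\<dots> \<le> (\<Sum>i\<in>UNIV. (if d i > 0 then Lam else lam) * d i)"
  proof (intro sum_mono weight_mult_le)
    fix i
    have "lam = (\<Sum>k\<in>UNIV. lam * (Q $ i $ k)\<^sup>2)" by (simp add: ss sum_distrib_left[symmetric])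
    also have "\<dots> \<le> (\<Sum>k\<in>UNIV. c k * (Q $ i $ k)\<^sup>2)" using c by (intro sum_mono mult_right_mono) auto
    finally show "lam \<le> (\<Sum>k\<in>UNIV. c k * (Q $ i $ k)\<^sup>2)" .
    have "(\<Sum>k\<in>UNIV. c k * (Q $ i $ k)\<^sup>2) \<le> (\<Sum>k\<in>UNIV. Lam * (Q $ i $ k)\<^sup>2)"
      using c by (intro sum_mono mult_right_mono) auto
    also have "\<dots> = Lam" by (simp add: ss sum_distrib_left[symmetric])
    finally show "(\<Sum>k\<in>UNIV. c k * (Q $ i $ k)\<^sup>2) \<le> Lam" .
  qed
  finally show ?thesis .
qed

section \<open>Second-order calculus\<close>

lemma C2_on_D:
  assumes "C2_on U f g H" "x \<in> U"
  shows "(f has_derivative (\<lambda>h. g x \<bullet> h)) (at x)" "(g has_derivative (\<lambda>h. H x *v h)) (at x)"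
  using assms by (auto simp: C2_on_def)

lemma C2_on_subset: "C2_on U f g H \<Longrightarrow> V \<subseteq> U \<Longrightarrow> C2_on V f g H"
  by (auto simp: C2_on_def intro: continuous_on_subset)

lemma C2_on_diff:
  assumes "C2_on U f g H" "C2_on U f' g' H'"
  shows "C2_on U (\<lambda>x. f x - f' x) (\<lambda>x. g x - g' x) (\<lambda>x. H x - H' x)"
  unfolding C2_on_def
proof (intro conjI ballI)
  fix x assume x: "x \<in> U"
  show "((\<lambda>x. f x - f' x) has_derivative (\<lambda>h. (g x - g' x) \<bullet> h)) (at x)"
    using has_derivative_diff[OF C2_on_D(1)[OF assms(1) x] C2_on_D(1)[OF assms(2) x]]
    by (simp add: inner_diff_left)
  show "((\<lambda>x. g x - g' x) has_derivative (\<lambda>h. (H x - H' x) *v h)) (at x)"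
    using has_derivative_diff[OF C2_on_D(2)[OF assms(1) x] C2_on_D(2)[OF assms(2) x]]
    by (simp add: matrix_vector_mult_diff_rdistrib)
next
  show "continuous_on U (\<lambda>x. H x - H' x)"
    using assms by (auto simp: C2_on_def intro: continuous_on_diff)
qed

section \<open>Symmetry and sign of Hessians\<close>

lemma C2_on_line_DERIV:
  assumes "C2_on U f g H" "x + t *\<^sub>R h \<in> U"
  shows "((\<lambda>t. f (x + t *\<^sub>R h)) has_real_derivative g (x + t *\<^sub>R h) \<bullet> h) (at t)"
    and "((\<lambda>t. g (x + t *\<^sub>R h) \<bullet> k) has_real_derivative (H (x + t *\<^sub>R h) *v h) \<bullet> k) (at t)"
proof -
  have l: "((\<lambda>t. x + t *\<^sub>R h) has_derivative (\<lambda>s. s *\<^sub>R h)) (at t)"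
    by (auto intro!: derivative_eq_intros)
  show "((\<lambda>t. f (x + t *\<^sub>R h)) has_real_derivative g (x + t *\<^sub>R h) \<bullet> h) (at t)"
    using has_derivative_compose[OF l C2_on_D(1)[OF assms]]
    by (simp add: has_field_derivative_def mult_commute_abs)
  show "((\<lambda>t. g (x + t *\<^sub>R h) \<bullet> k) has_real_derivative (H (x + t *\<^sub>R h) *v h) \<bullet> k) (at t)"
    using has_derivative_inner_left[OF has_derivative_compose[OF l C2_on_D(2)[OF assms]], of k]
    by (simp add: has_field_derivative_def mult_commute_abs matrix_vector_mult_scaleR)
qed

text \<open>The second difference is a first difference in direction \<open>u\<close> of a first
  difference in direction \<open>v\<close>. The mean value theorem along \<open>u\<close> reduces it
  to a difference of gradients, which the expansion of \<open>g\<close> at \<open>x\<close>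
  evaluates as t H(x)v up to o(t).\<close>

lemma C2_on_second_difference:
  fixes x u v :: "real^'n"
  assumes C2: "C2_on U f g H" and U: "open U" "x \<in> U"
  shows "((\<lambda>t. (f (x + t *\<^sub>R u + t *\<^sub>R v) - f (x + t *\<^sub>R u) - f (x + t *\<^sub>R v) + f x) / t\<^sup>2)
           \<longlongrightarrow> (H x *v v) \<bullet> u) (at_right 0)"
proof (rule tendstoI)
  fix \<epsilon> :: real assume \<epsilon>: "\<epsilon> > 0"
  define N where "N = norm u + norm v"
  \<comment> \<open>The final error is at most \<open>\<eta> * (2 * N * norm u)\<close>; the added 1
    keeps the denominator positive when \<open>u\<close> vanishes.\<close>
  define \<eta> where "\<eta> = \<epsilon> / (4 * N * norm u + 1)"
  have N: "0 \<le> N" by (simp add: N_def)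
  have den: "0 < 4 * N * norm u + 1" using N by (simp add: add_nonneg_pos)
  have \<eta>: "0 < \<eta>" using \<epsilon> den by (simp add: \<eta>_def)
  have lin: "bounded_linear (\<lambda>h. H x *v h)" by simp
  obtain d1 where d1: "d1 > 0" "\<And>y. norm (y - x) < d1 \<Longrightarrow>
      norm (g y - g x - H x *v (y - x)) \<le> \<eta> * norm (y - x)"
    using C2_on_D(2)[OF C2 U(2)] \<eta> unfolding has_derivative_at_alt by blast
  obtain d2 where d2: "d2 > 0" "ball x d2 \<subseteq> U" using U open_contains_ball by blast
  \<comment> \<open>For t below \<open>d\<close> the whole parallelogram spanned by tu and tv stays
    both in \<open>U\<close> and where the expansion of \<open>g\<close> is accurate.\<close>
  define d where "d = min d1 d2 / (N + 1)"
  have d: "0 < d" using d1 d2 N by (simp add: d_def)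
  have "dist ((f (x + t *\<^sub>R u + t *\<^sub>R v) - f (x + t *\<^sub>R u) - f (x + t *\<^sub>R v) + f x) / t\<^sup>2)
      ((H x *v v) \<bullet> u) < \<epsilon>" if t: "0 < t" "t < d" for t
  proof -
    have tN: "t * N < min d1 d2"
    proof -
      have "t * N \<le> t * (N + 1)" using t by simp
      also have "\<dots> < min d1 d2" using t N by (simp add: d_def field_simps)
      finally show ?thesis .
    qed
    have near: "norm (s *\<^sub>R u + r *\<^sub>R v) \<le> t * N" if "0 \<le> s" "s \<le> t" "0 \<le> r" "r \<le> t" for s r
    proof -
      have "norm (s *\<^sub>R u + r *\<^sub>R v) \<le> s * norm u + r * norm v"
        using norm_triangle_ineq[of "s *\<^sub>R u" "r *\<^sub>R v"] that by simp
      also have "\<dots> \<le> t * norm u + t * norm v"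
        using that by (intro add_mono mult_right_mono) auto
      finally show ?thesis by (simp add: N_def algebra_simps)
    qed
    have inU: "x + s *\<^sub>R u + r *\<^sub>R v \<in> U" if "0 \<le> s" "s \<le> t" "0 \<le> r" "r \<le> t" for s r
    proof -
      have "dist x (x + s *\<^sub>R u + r *\<^sub>R v) = norm (s *\<^sub>R u + r *\<^sub>R v)"
      proof -
        have "x - (x + s *\<^sub>R u + r *\<^sub>R v) = - (s *\<^sub>R u + r *\<^sub>R v)" by simp
        then show ?thesis by (simp only: dist_norm norm_minus_cancel)
      qed
      also have "\<dots> < d2" using near[OF that] tN by simp
      finally show ?thesis using d2(2) by auto
    qed
    let ?\<phi> = "\<lambda>s. f (x + t *\<^sub>R v + s *\<^sub>R u) - f (x + s *\<^sub>R u)"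
    have "\<exists>s. 0 < s \<and> s < t \<and> ?\<phi> t - ?\<phi> 0 =
        (t - 0) * (g (x + t *\<^sub>R v + s *\<^sub>R u) \<bullet> u - g (x + s *\<^sub>R u) \<bullet> u)"
    proof (rule MVT2)
      fix s :: real assume s: "0 \<le> s" "s \<le> t"
      have "x + t *\<^sub>R v + s *\<^sub>R u \<in> U" "x + s *\<^sub>R u \<in> U"
        using inU[of s t] inU[of s 0] s t by (simp_all add: add_ac)
      then show "(?\<phi> has_real_derivative g (x + t *\<^sub>R v + s *\<^sub>R u) \<bullet> u - g (x + s *\<^sub>R u) \<bullet> u) (at s)"
        by (intro DERIV_diff C2_on_line_DERIV(1)[OF C2])
    qed (use t in simp)
    then obtain s where s: "0 < s" "s < t" and eq: "?\<phi> t - ?\<phi> 0 =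
        t * (g (x + t *\<^sub>R v + s *\<^sub>R u) \<bullet> u - g (x + s *\<^sub>R u) \<bullet> u)" by auto
    \<comment> \<open>\<open>a\<close> and \<open>b\<close> are the remainders of the first-order
      expansion of \<open>g\<close> at two points whose difference is tv; subtracting cancels
      \<open>g x\<close> and leaves t H(x)v.\<close>
    define a where "a = g (x + t *\<^sub>R v + s *\<^sub>R u) - g x - H x *v (t *\<^sub>R v + s *\<^sub>R u)"
    define b where "b = g (x + s *\<^sub>R u) - g x - H x *v (s *\<^sub>R u)"
    have "norm a \<le> \<eta> * norm (t *\<^sub>R v + s *\<^sub>R u)"
      unfolding a_def using d1(2)[of "x + t *\<^sub>R v + s *\<^sub>R u"] near[of s t] s t tN
      by (simp add: add_ac)
    also have "\<dots> \<le> \<eta> * (t * N)"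
      using near[of s t] s t \<eta> by (intro mult_left_mono) (auto simp: add_ac)
    finally have a: "norm a \<le> \<eta> * (t * N)" .
    have "norm b \<le> \<eta> * norm (s *\<^sub>R u)"
      unfolding b_def using d1(2)[of "x + s *\<^sub>R u"] near[of s 0] s t tN by simp
    also have "\<dots> \<le> \<eta> * (t * N)"
      using near[of s 0] s t \<eta> by (intro mult_left_mono) auto
    finally have b: "norm b \<le> \<eta> * (t * N)" .
    have "g (x + t *\<^sub>R v + s *\<^sub>R u) - g (x + s *\<^sub>R u) = t *\<^sub>R (H x *v v) + (a - b)"
      by (simp add: a_def b_def matrix_vector_right_distrib matrix_vector_mult_scaleR)
    then have "?\<phi> t - ?\<phi> 0 = t * (t * ((H x *v v) \<bullet> u) + (a - b) \<bullet> u)"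
      unfolding eq inner_diff_left[symmetric] by (simp add: inner_add_left)
    then have "(?\<phi> t - ?\<phi> 0) / t\<^sup>2 - (H x *v v) \<bullet> u = ((a - b) \<bullet> u) / t"
      using t by (simp add: field_simps power2_eq_square)
    moreover have "\<bar>(a - b) \<bullet> u\<bar> \<le> 2 * (\<eta> * (t * N)) * norm u"
    proof -
      have "\<bar>(a - b) \<bullet> u\<bar> \<le> norm (a - b) * norm u" by (rule Cauchy_Schwarz_ineq2)
      also have "\<dots> \<le> (2 * (\<eta> * (t * N))) * norm u"
        using norm_triangle_ineq4[of a b] a b by (intro mult_right_mono) auto
      finally show ?thesis .
    qed
    then have "\<bar>((a - b) \<bullet> u) / t\<bar> \<le> \<eta> * (2 * N * norm u)"
      using t by (simp add: abs_divide field_simps)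
    moreover have "\<eta> * (2 * N * norm u) < \<epsilon>"
    proof -
      have "\<eta> * (2 * N * norm u) \<le> \<eta> * (4 * N * norm u)" using \<eta> N by simp
      also have "\<dots> < \<eta> * (4 * N * norm u + 1)" using \<eta> by simp
      also have "\<dots> = \<epsilon>" using den by (simp add: \<eta>_def)
      finally show ?thesis .
    qed
    ultimately have "\<bar>(?\<phi> t - ?\<phi> 0) / t\<^sup>2 - (H x *v v) \<bullet> u\<bar> < \<epsilon>" by linarith
    moreover have "?\<phi> t - ?\<phi> 0 = f (x + t *\<^sub>R u + t *\<^sub>R v) - f (x + t *\<^sub>R u) - f (x + t *\<^sub>R v) + f x"
      by (simp add: add_ac)
    ultimately show ?thesis by (simp only: dist_real_def)
  qed
  then show "\<forall>\<^sub>F t in at_right 0. dist ((f (x + t *\<^sub>R u + t *\<^sub>R v) - f (x + t *\<^sub>R u)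
      - f (x + t *\<^sub>R v) + f x) / t\<^sup>2) ((H x *v v) \<bullet> u) < \<epsilon>"
    using d by (intro eventually_at_rightI[of 0 d]) auto
qed

text \<open>The second difference is invariant under exchanging \<open>u\<close> and
  \<open>v\<close>, so its two limits agree. This supplies the symmetry that the Pucci estimates
  require of the Hessian of a test function.\<close>

lemma C2_on_hessian_symmetric:
  fixes x :: "real^'n"
  assumes C2: "C2_on U f g H" and U: "open U" "x \<in> U"
  shows "transpose (H x) = H x"
proof -
  have *: "(H x *v v) \<bullet> u = (H x *v u) \<bullet> v" for u v
  proof -
    have eq: "f (x + t *\<^sub>R u + t *\<^sub>R v) - f (x + t *\<^sub>R u) - f (x + t *\<^sub>R v) + f x =
        f (x + t *\<^sub>R v + t *\<^sub>R u) - f (x + t *\<^sub>R v) - f (x + t *\<^sub>R u) + f x" for t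
      by (simp add: add_ac)
    have "((\<lambda>t. (f (x + t *\<^sub>R u + t *\<^sub>R v) - f (x + t *\<^sub>R u) - f (x + t *\<^sub>R v) + f x) / t\<^sup>2)
           \<longlongrightarrow> (H x *v u) \<bullet> v) (at_right 0)"
      unfolding eq by (rule C2_on_second_difference[OF C2 U])
    from tendsto_unique[OF trivial_limit_at_right_real C2_on_second_difference[OF C2 U] this]
    show ?thesis .
  qed
  have "H x $ i $ j = H x $ j $ i" for i j
    using *[of "axis j 1" "axis i 1"]
    by (simp add: matrix_vector_mult_basis inner_axis column_def)
  then show ?thesis by (simp add: transpose_def vec_eq_iff)
qed

text \<open>Along the line in direction \<open>h\<close> the first derivative vanishes at the
  minimum. A negative second derivative would make it negative just to the right, so
  \<open>f\<close> would drop below \<open>f x\<close>.\<close>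

lemma C2_on_local_min_hessian:
  fixes x :: "real^'n"
  assumes C2: "C2_on U f g H" and U: "open U" "x \<in> U" and min: "\<And>y. y \<in> U \<Longrightarrow> f x \<le> f y"
  shows "0 \<le> h \<bullet> (H x *v h)"
proof (rule ccontr)
  assume neg: "\<not> ?thesis"
  have "((\<lambda>t. x + t *\<^sub>R h) \<longlongrightarrow> x + 0 *\<^sub>R h) (at 0)" by (intro tendsto_intros)
  then have "\<forall>\<^sub>F t in at 0. x + t *\<^sub>R h \<in> U"
    using U by (auto elim!: topological_tendstoD)
  then obtain e where e0: "e > 0" "\<And>t. t \<noteq> 0 \<Longrightarrow> \<bar>t\<bar> < e \<Longrightarrow> x + t *\<^sub>R h \<in> U"
    unfolding eventually_at by auto
  have e: "e > 0" "\<And>t. \<bar>t\<bar> < e \<Longrightarrow> x + t *\<^sub>R h \<in> U"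
  proof -
    show "x + t *\<^sub>R h \<in> U" if "\<bar>t\<bar> < e" for t
      using that e0(2)[of t] U(2) by (cases "t = 0") auto
  qed (fact e0(1))
  let ?p = "\<lambda>t. f (x + t *\<^sub>R h)" and ?p' = "\<lambda>t. g (x + t *\<^sub>R h) \<bullet> h"
  have D: "(?p has_real_derivative ?p' t) (at t)" if "\<bar>t\<bar> < e" for t
    using C2_on_line_DERIV(1)[OF C2 e(2)[OF that]] .
  have p'0: "?p' 0 = 0"
  proof (rule DERIV_local_min[OF D[of 0] e(1)])
    show "\<forall>s. \<bar>0 - s\<bar> < e \<longrightarrow> ?p 0 \<le> ?p s"
      using min[OF e(2)] by simp
  qed (use e(1) in simp)
  have "(?p' has_real_derivative (H x *v h) \<bullet> h) (at 0)"
    using C2_on_line_DERIV(2)[OF C2 e(2)[of 0], of h] e(1) by simp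
  from DERIV_neg_dec_right[OF this] neg
  obtain r where r: "r > 0" "\<And>t. 0 < t \<Longrightarrow> t < r \<Longrightarrow> ?p' t < 0"
    using p'0 by (auto simp: inner_commute)
  define t where "t = min e r / 2"
  have t: "0 < t" "t < e" "t < r" using e r by (auto simp: t_def)
  have "?p t < ?p 0"
  proof (rule DERIV_neg_imp_decreasing_open[OF t(1)])
    show "\<exists>y. (?p has_real_derivative y) (at s) \<and> y < 0" if "0 < s" "s < t" for s
      by (rule exI[of _ "?p' s"], rule conjI[OF D r(2)]) (use that t in auto)
    show "continuous_on {0..t} ?p"
      by (rule DERIV_continuous_on[OF has_field_derivative_at_within[OF D]]) (use t in auto)
  qed
  moreover have "f x \<le> ?p t" by (rule min, rule e(2)) (use t in simp)
  ultimately show False by simp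
qed

section \<open>Hessians of composite and separable functions\<close>

lemma C2_on_compose:
  fixes F :: "real^'n \<Rightarrow> real"
  assumes C2: "C2_on U F g H"
    and G: "\<And>x. x \<in> U \<Longrightarrow> (G has_real_derivative G' (F x)) (at (F x))"
    and G': "\<And>x. x \<in> U \<Longrightarrow> (G' has_real_derivative G'' (F x)) (at (F x))"
    and cont: "continuous_on (F ` U) G''"
  shows "C2_on U (\<lambda>x. G (F x)) (\<lambda>x. G' (F x) *\<^sub>R g x)
    (\<lambda>x. \<chi> i j. G' (F x) * H x $ i $ j + G'' (F x) * (g x $ i * g x $ j))"
  unfolding C2_on_def
proof (intro conjI ballI)
  fix x assume x: "x \<in> U"
  note DF = C2_on_D(1)[OF C2 x] and Dg = C2_on_D(2)[OF C2 x]
  show "((\<lambda>x. G (F x)) has_derivative (\<lambda>h. (G' (F x) *\<^sub>R g x) \<bullet> h)) (at x)"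
    using has_derivative_compose[OF DF G[OF x, unfolded has_field_derivative_def]] by simp
  have "((\<lambda>x. G' (F x)) has_derivative (\<lambda>h. G'' (F x) * (g x \<bullet> h))) (at x)"
    using has_derivative_compose[OF DF G'[OF x, unfolded has_field_derivative_def]] .
  from has_derivative_scaleR[OF this Dg]
  have "((\<lambda>x. G' (F x) *\<^sub>R g x) has_derivative
      (\<lambda>h. G' (F x) *\<^sub>R (H x *v h) + (G'' (F x) * (g x \<bullet> h)) *\<^sub>R g x)) (at x)" .
  moreover have "G' (F x) *\<^sub>R (H x *v h) + (G'' (F x) * (g x \<bullet> h)) *\<^sub>R g x =
      (\<chi> i j. G' (F x) * H x $ i $ j + G'' (F x) * (g x $ i * g x $ j)) *v h" for h
  proof -
    have "G' (F x) * (\<Sum>j\<in>UNIV. H x $ i $ j * h $ j) + G'' (F x) * (\<Sum>j\<in>UNIV. g x $ j * h $ j) * g x $ i =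
        (\<Sum>j\<in>UNIV. (G' (F x) * H x $ i $ j + G'' (F x) * (g x $ i * g x $ j)) * h $ j)" for i
      unfolding sum_distrib_left sum_distrib_right sum.distrib[symmetric]
      by (rule sum.cong) (simp_all add: algebra_simps)
    then show ?thesis
      by (simp add: vec_eq_iff matrix_vector_mult_def inner_vec_def)
  qed
  ultimately show "((\<lambda>x. G' (F x) *\<^sub>R g x) has_derivative
      (\<lambda>h. (\<chi> i j. G' (F x) * H x $ i $ j + G'' (F x) * (g x $ i * g x $ j)) *v h)) (at x)"
    by (simp only:)
next
  have F: "continuous_on U F" and g: "continuous_on U g"
    by (rule has_derivative_continuous_on[OF has_derivative_at_withinI], erule C2_on_D[OF C2])+
  have H: "continuous_on U H" using C2 by (simp add: C2_on_def)
  have "continuous_on (F ` U) G'"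
    by (rule DERIV_continuous_on[where D = G'']) (auto intro: has_field_derivative_at_within G')
  then have 1: "continuous_on U (\<lambda>x. G' (F x))"
    using F by (rule continuous_on_compose2) auto
  have 2: "continuous_on U (\<lambda>x. G'' (F x))"
    using cont F by (rule continuous_on_compose2) auto
  show "continuous_on U (\<lambda>x. \<chi> i j. G' (F x) * H x $ i $ j + G'' (F x) * (g x $ i * g x $ j))"
  proof (intro continuous_on_vec_lambda)
    fix i j
    have gc: "continuous_on U (\<lambda>x. g x $ i)" for i using g by (rule continuous_on_component)
    have Hc: "continuous_on U (\<lambda>x. H x $ i $ j)"
      using continuous_on_component[OF continuous_on_component[OF H]] .
    show "continuous_on U (\<lambda>x. G' (F x) * H x $ i $ j + G'' (F x) * (g x $ i * g x $ j))"
      using continuous_on_add[OF continuous_on_mult[OF 1 Hc] continuous_on_mult[OF 2 continuous_on_mult[OF gc gc]]] .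
  qed
qed

lemma C2_on_separable:
  fixes c :: "'n::finite \<Rightarrow> real"
  assumes f: "\<And>t. (f has_real_derivative f' t) (at t)"
    and f': "\<And>t. (f' has_real_derivative f'' t) (at t)"
    and cont: "continuous_on UNIV f''"
  shows "C2_on UNIV (\<lambda>p::real^'n. \<Sum>i\<in>UNIV. c i * f (p $ i)) (\<lambda>p. \<chi> i. c i * f' (p $ i))
    (\<lambda>p. \<chi> i j. if i = j then c i * f'' (p $ i) else 0)"
  unfolding C2_on_def
proof (intro conjI ballI)
  fix p :: "real^'n"
  have nth: "((\<lambda>p. p $ i) has_derivative (\<lambda>h. h $ i)) (at p)" for i
    by (intro bounded_linear_imp_has_derivative bounded_linear_vec_nth)
  have D: "((\<lambda>p. c i * k (p $ i)) has_derivative (\<lambda>h. c i * k' * h $ i)) (at p)"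
    if "(k has_real_derivative k') (at (p $ i))" for i k k'
    using has_derivative_mult_right[OF has_derivative_compose[OF nth that[unfolded has_field_derivative_def]], of "c i"]
    by (simp add: mult.assoc)
  show "((\<lambda>p. \<Sum>i\<in>UNIV. c i * f (p $ i)) has_derivative (\<lambda>h. (\<chi> i. c i * f' (p $ i)) \<bullet> h)) (at p)"
    unfolding inner_vec_def using has_derivative_sum[OF D[OF f]] by simp
  show "((\<lambda>p. \<chi> i. c i * f' (p $ i)) has_derivative
      (\<lambda>h. (\<chi> i j. if i = j then c i * f'' (p $ i) else 0) *v h)) (at p)"
    unfolding has_derivative_componentwise_within[where f = "\<lambda>p. \<chi> i. c i * f' (p $ i)"]
    using D[OF f'] 
    by (auto simp: Basis_vec_def inner_axis matrix_vector_mult_def if_distrib if_distribR cong: if_cong)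
next
  show "continuous_on UNIV (\<lambda>p::real^'n. \<chi> i j. if i = j then c i * f'' (p $ i) else 0)"
  proof (intro continuous_on_vec_lambda)
    fix i j
    have "continuous_on UNIV (\<lambda>p::real^'n. f'' (p $ i))"
      by (rule continuous_on_compose2[OF cont]) (auto intro: continuous_intros)
    then show "continuous_on UNIV (\<lambda>p::real^'n. if i = j then c i * f'' (p $ i) else 0)"
      by (cases "i = j") (auto intro: continuous_intros)
  qed
qed

section \<open>The profile\<close>

text \<open>Dividing the argument by \<open>s\<close> gives f'' = -f/s^2 on the outer part, and the
  factor \<open>s\<close> makes both slopes at pi/2 equal to -1. Both second derivatives vanish
  there, so the pieces join to second order.\<close>

definition half_profile :: "real \<Rightarrow> real \<Rightarrow> real" where
  "half_profile s t = (if t \<le> pi/2 then cos t else - s * sin ((t - pi/2) / s))"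

definition half_profile' :: "real \<Rightarrow> real \<Rightarrow> real" where
  "half_profile' s t = (if t \<le> pi/2 then - sin t else - cos ((t - pi/2) / s))"

definition half_profile'' :: "real \<Rightarrow> real \<Rightarrow> real" where
  "half_profile'' s t = (if t \<le> pi/2 then - cos t else sin ((t - pi/2) / s) / s)"

definition profile :: "real \<Rightarrow> real \<Rightarrow> real" where
  "profile s t = half_profile s \<bar>t\<bar>"

definition profile' :: "real \<Rightarrow> real \<Rightarrow> real" where
  "profile' s t = sgn t * half_profile' s \<bar>t\<bar>"

definition profile'' :: "real \<Rightarrow> real \<Rightarrow> real" where
  "profile'' s t = half_profile'' s \<bar>t\<bar>"

lemma has_real_derivative_glue:
  fixes f g :: "real \<Rightarrow> real"
  assumes f: "(f has_real_derivative D) (at c)" and g: "(g has_real_derivative D) (at c)"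
    and eq: "f c = g c"
  shows "((\<lambda>t. if t \<le> c then f t else g t) has_real_derivative D) (at c)"
  unfolding has_field_derivative_iff
proof (rule filterlim_split_at_real)
  let ?k = "\<lambda>t. if t \<le> c then f t else g t"
  have l: "((\<lambda>y. (f y - f c) / (y - c)) \<longlongrightarrow> D) (at_left c)"
    using f unfolding has_field_derivative_iff by (rule tendsto_within_subset) simp
  have "\<forall>\<^sub>F y in at_left c. (?k y - ?k c) / (y - c) = (f y - f c) / (y - c)"
    by (rule eventually_at_leftI[of "c - 1"]) auto
  from tendsto_cong[OF this, THEN iffD2, OF l]
  show "((\<lambda>y. (?k y - ?k c) / (y - c)) \<longlongrightarrow> D) (at_left c)" .
  have r: "((\<lambda>y. (g y - g c) / (y - c)) \<longlongrightarrow> D) (at_right c)"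
    using g unfolding has_field_derivative_iff by (rule tendsto_within_subset) simp
  have "\<forall>\<^sub>F y in at_right c. (?k y - ?k c) / (y - c) = (g y - g c) / (y - c)"
    using eq by (intro eventually_at_rightI[of c "c + 1"]) auto
  from tendsto_cong[OF this, THEN iffD2, OF r]
  show "((\<lambda>y. (?k y - ?k c) / (y - c)) \<longlongrightarrow> D) (at_right c)" .
qed

lemma has_real_derivative_if_le:
  fixes f g :: "real \<Rightarrow> real"
  assumes f: "\<And>t. (f has_real_derivative f' t) (at t)" and g: "\<And>t. (g has_real_derivative g' t) (at t)"
    and eq: "f c = g c" "f' c = g' c"
  shows "((\<lambda>t. if t \<le> c then f t else g t) has_real_derivative (if t \<le> c then f' t else g' t)) (at t)"
proof (cases t c rule: linorder_cases)
  case less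
  then show ?thesis
    using has_field_derivative_transform_within_open[OF f[of t], of "{..<c}"] by auto
next
  case equal
  then show ?thesis using has_real_derivative_glue[OF f[of c], of g] g[of c] eq by simp
next
  case greater
  then show ?thesis
    using has_field_derivative_transform_within_open[OF g[of t], of "{c<..}"] by auto
qed

lemma half_profile_DERIV:
  assumes "s > 0"
  shows "(half_profile s has_real_derivative half_profile' s t) (at t)"
    and "(half_profile' s has_real_derivative half_profile'' s t) (at t)"
proof -
  show "(half_profile s has_real_derivative half_profile' s t) (at t)"
    unfolding half_profile_def[abs_def] half_profile'_def
    by (rule has_real_derivative_if_le) (use assms in \<open>auto intro!: derivative_eq_intros\<close>)
  show "(half_profile' s has_real_derivative half_profile'' s t) (at t)"
    unfolding half_profile'_def[abs_def] half_profile''_def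
    by (rule has_real_derivative_if_le) (use assms in \<open>auto intro!: derivative_eq_intros\<close>)
qed

text \<open>Since cosine is even, \<open>profile\<close> coincides with \<open>half_profile\<close>
  on all of (-pi/2, \<infinity>) and with its mirror image on (-\<infinity>, pi/2). These open
  half-lines cover the line, so the kink of the absolute value at 0 never has to be treated.\<close>

lemma profile_DERIV:
  assumes s: "s > 0"
  shows "(profile s has_real_derivative profile' s t) (at t)"
    and "(profile' s has_real_derivative profile'' s t) (at t)"
proof -
  have pos: "profile s u = half_profile s u" "profile' s u = half_profile' s u"
    "profile'' s u = half_profile'' s u" if "u > - (pi/2)" for u
    using that by (auto simp: profile_def profile'_def profile''_def half_profile_def half_profile'_def
        half_profile''_def sgn_if abs_if)
  have neg: "profile s u = half_profile s (- u)" "profile' s u = - half_profile' s (- u)"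
    "profile'' s u = half_profile'' s (- u)" if "u < pi/2" for u
    using that by (auto simp: profile_def profile'_def profile''_def half_profile_def half_profile'_def
        half_profile''_def sgn_if abs_if)
  note D = half_profile_DERIV[OF s]
  have "(profile s has_real_derivative profile' s t) (at t) \<and> (profile' s has_real_derivative profile'' s t) (at t)"
  proof (cases "t > - (pi/2)")
    case True
    then show ?thesis
      using has_field_derivative_transform_within_open[OF D(1)[of t], of "{- (pi/2)<..}" "profile s"]
        has_field_derivative_transform_within_open[OF D(2)[of t], of "{- (pi/2)<..}" "profile' s"]
      by (auto simp: pos)
  next
    case False
    then have t: "t < pi/2" using pi_gt_zero by linarith
    have "((\<lambda>u. half_profile s (- u)) has_real_derivative - half_profile' s (- t)) (at t)"
      "((\<lambda>u. - half_profile' s (- u)) has_real_derivative half_profile'' s (- t)) (at t)"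
      using DERIV_mirror[THEN iffD1, OF D(1)[of "- t"]]
        DERIV_minus[OF DERIV_mirror[THEN iffD1, OF D(2)[of "- t"]]] by simp_all
    from has_field_derivative_transform_within_open[OF this(1), of "{..<pi/2}" "profile s"]
      has_field_derivative_transform_within_open[OF this(2), of "{..<pi/2}" "profile' s"]
    show ?thesis using t by (auto simp: neg)
  qed
  then show "(profile s has_real_derivative profile' s t) (at t)"
    "(profile' s has_real_derivative profile'' s t) (at t)" by auto
qed

lemma continuous_on_profile'':
  assumes "s > 0"
  shows "continuous_on UNIV (profile'' s)"
proof -
  have *: "- cos t = sin ((t - pi/2) / s) / s" if "t * 2 = pi" for t
  proof -
    have "t = pi/2" using that by simp
    show ?thesis unfolding \<open>t = pi/2\<close> by simp
  qed
  have "continuous_on ({..pi/2} \<union> {pi/2..}) (\<lambda>t. if t \<le> pi/2 then - cos t else sin ((t - pi/2) / s) / s)"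
    by (rule continuous_on_If) (use assms in \<open>auto intro!: continuous_intros *\<close>)
  moreover have "{..pi/2} \<union> {pi/2..} = (UNIV :: real set)" by auto
  ultimately have "continuous_on UNIV (half_profile'' s)"
    by (simp add: half_profile''_def[abs_def])
  then show ?thesis
    unfolding profile''_def[abs_def] by (rule continuous_on_compose2) (auto intro: continuous_intros)
qed

lemma half_profile_cos: "t \<le> pi/2 \<Longrightarrow> half_profile s t = cos t"
  by (simp add: half_profile_def)

lemma half_profile_sin: "pi/2 \<le> t \<Longrightarrow> half_profile s t = - s * sin ((t - pi/2) / s)"
proof (cases "t = pi/2")
  case True
  show ?thesis unfolding True by (simp add: half_profile_def)
qed (simp add: half_profile_def)

lemma half_profile_end: "s > 0 \<Longrightarrow> half_profile s (pi/2 + s * (pi/2)) = - s"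
  by (simp add: half_profile_sin)

text \<open>The end point \<open>pi/2 + s * (pi/2)\<close> is where the stretched sine has argument
  pi/2: it is the first positive zero of the derivative, which is negative before it.\<close>

lemma half_profile_strict_antimono:
  assumes s: "s > 0" and ab: "0 \<le> a" "a < b" "b \<le> pi/2 + s * (pi/2)"
  shows "half_profile s b < half_profile s a"
proof (rule DERIV_neg_imp_decreasing_open[OF ab(2)])
  fix t assume t: "a < t" "t < b"
  have "half_profile' s t < 0"
  proof (cases "t \<le> pi/2")
    case True
    then have "sin t > 0" using t ab by (intro sin_gt_zero) auto
    then show ?thesis using True by (simp add: half_profile'_def)
  next
    case False
    then have "0 < (t - pi/2) / s" using s by simp
    moreover have "(t - pi/2) / s < pi/2" using t ab s by (simp add: pos_divide_less_eq mult.commute)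
    ultimately have "cos ((t - pi/2) / s) > 0"
      using pi_gt_zero by (intro cos_gt_zero_pi) linarith+
    then show ?thesis using False by (simp add: half_profile'_def)
  qed
  then show "\<exists>y. (half_profile s has_real_derivative y) (at t) \<and> y < 0"
    using half_profile_DERIV(1)[OF s] by blast
next
  show "continuous_on {a..b} (half_profile s)"
    by (rule DERIV_continuous_on[OF has_field_derivative_at_within[OF half_profile_DERIV(1)[OF s]]])
qed

lemma half_profile_le_1: "s > 0 \<Longrightarrow> 0 \<le> t \<Longrightarrow> t \<le> pi/2 + s * (pi/2) \<Longrightarrow> half_profile s t \<le> 1"
  using half_profile_strict_antimono[of s 0 t] by (cases "t = 0") (auto simp: half_profile_cos)

lemma half_profile_ge: "s > 0 \<Longrightarrow> 0 \<le> t \<Longrightarrow> t \<le> pi/2 + s * (pi/2) \<Longrightarrow> - s \<le> half_profile s t"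
  using half_profile_strict_antimono[of s t "pi/2 + s * (pi/2)"] half_profile_end[of s]
  by (cases "t = pi/2 + s * (pi/2)") auto

lemma half_profile_nonneg: "0 \<le> t \<Longrightarrow> t \<le> pi/2 \<Longrightarrow> 0 \<le> half_profile s t"
  by (simp add: half_profile_cos cos_ge_zero)

lemma half_profile_neg:
  assumes "s > 0" "pi/2 < t" "t \<le> pi/2 + s * (pi/2)"
  shows "half_profile s t < 0"
  using half_profile_strict_antimono[of s "pi/2" t] assms by (simp add: half_profile_cos)

text \<open>Both bounds are 1 - c^2 >= 1 - c for c in [0,1], with c the cosine on the inner part and
  the sine on the outer one. Near the minimum the squared slope is thus at least linear in the
  height above -s, even though the slope itself vanishes there.\<close>

lemma half_profile'_square_ge:
  assumes s: "s > 0" and t: "0 \<le> t" "t \<le> pi/2 + s * (pi/2)"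
  shows "half_profile s t \<le> 0 \<Longrightarrow> 1 + half_profile s t / s \<le> (half_profile' s t)\<^sup>2"
    and "half_profile s t \<ge> 0 \<Longrightarrow> 1 - half_profile s t \<le> (half_profile' s t)\<^sup>2"
proof -
  have 1: "half_profile s t \<ge> 0 \<longleftrightarrow> t \<le> pi/2"
    using half_profile_nonneg[of t s] half_profile_neg[OF s, of t] t by force
  have c: "1 - cos t \<le> (sin t)\<^sup>2" if "0 \<le> cos t"
  proof -
    have "(cos t)\<^sup>2 \<le> cos t"
      using that mult_left_mono[OF cos_le_one[of t], of "cos t"] by (simp add: power2_eq_square)
    then show ?thesis by (simp add: sin_squared_eq)
  qed
  show "1 - half_profile s t \<le> (half_profile' s t)\<^sup>2" if "half_profile s t \<ge> 0"
    using that 1 c by (simp add: half_profile_def half_profile'_def)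
  show "1 + half_profile s t / s \<le> (half_profile' s t)\<^sup>2" if le: "half_profile s t \<le> 0"
  proof (cases "t \<le> pi/2")
    case True
    then have "cos t = 0" using le t cos_ge_zero[of t] by (simp add: half_profile_def)
    then show ?thesis using True by (simp add: half_profile_def half_profile'_def sin_squared_eq)
  next
    case False
    let ?v = "sin ((t - pi/2) / s)"
    have "0 \<le> ?v" using False le s by (simp add: half_profile_def zero_le_mult_iff)
    then have "?v\<^sup>2 \<le> ?v" using mult_left_mono[OF sin_le_one, of ?v] by (simp add: power2_eq_square)
    then show ?thesis using False s by (simp add: half_profile_def half_profile'_def cos_squared_eq)
  qed
qed

text \<open>On the cosine part f'' = -f is nonpositive and receives the weight \<open>lam\<close>;
  on the sine part f'' = -f/s^2 is positive and receives \<open>Lam\<close>, whose factor s^2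
  cancels the stretching.\<close>

lemma profile_pucci_weight:
  assumes s: "s > 0" and c: "c > 0" and t: "\<bar>t\<bar> \<le> pi/2 + s * (pi/2)" and Lam: "Lam = s\<^sup>2 * lam"
  shows "(if c * profile'' s t > 0 then Lam else lam) * (c * profile'' s t) = - (lam * (c * profile s t))"
proof (cases "\<bar>t\<bar> \<le> pi/2")
  case True
  then have "0 \<le> cos \<bar>t\<bar>" by (intro cos_ge_zero) auto
  then show ?thesis using True c by (simp add: profile_def profile''_def half_profile_def half_profile''_def
        mult_less_0_iff not_less)
next
  case False
  then have "half_profile s \<bar>t\<bar> < 0" using half_profile_neg[OF s] t by simp
  then have "sin ((\<bar>t\<bar> - pi/2) / s) > 0" using False s by (simp add: half_profile_def zero_less_mult_iff)
  then show ?thesis using False c s Lam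
    by (simp add: profile_def profile''_def half_profile_def half_profile''_def power2_eq_square)
qed

section \<open>The domain\<close>

text \<open>Monotonicity of sine on [-pi/2, pi/2] trades the inverse function for an inequality on
  the profile. The cap \<open>pi/2 + s * (pi/2)\<close> has to be stated on the right, because
  beyond it the sine falls again.\<close>

lemma le_arcsin_scaled_iff:
  assumes "s > 0" "0 \<le> a" "a \<le> 1"
  shows "pi/2 \<le> z \<and> z \<le> pi/2 + s * arcsin a \<longleftrightarrow>
    pi/2 \<le> z \<and> z \<le> pi/2 + s * (pi/2) \<and> - half_profile s z \<le> s * a"
proof (cases "pi/2 \<le> z \<and> z \<le> pi/2 + s * (pi/2)")
  case True
  then have "- (pi/2) \<le> (z - pi/2) / s" "(z - pi/2) / s \<le> pi/2"
    using assms pi_gt_zero by (simp_all add: field_simps)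
  then have "(z - pi/2) / s \<le> arcsin a \<longleftrightarrow> sin ((z - pi/2) / s) \<le> a"
    using assms by (intro le_arcsin_iff) auto
  moreover have "(z - pi/2) / s \<le> arcsin a \<longleftrightarrow> z \<le> pi/2 + s * arcsin a"
    using assms by (auto simp: field_simps)
  moreover have "- half_profile s z = s * sin ((z - pi/2) / s)"
    using True by (simp add: half_profile_sin)
  ultimately show ?thesis using True assms by simp
next
  case False
  have "s * arcsin a \<le> s * (pi/2)" using assms arcsin_ubound[of a] by (intro mult_left_mono) auto
  then show ?thesis using False by auto
qed

lemma le_arccos_nonneg_iff:
  assumes "0 \<le> a" "a \<le> 1"
  shows "0 \<le> y \<and> y \<le> arccos a \<longleftrightarrow> 0 \<le> y \<and> y \<le> pi/2 \<and> a \<le> half_profile s y"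
proof -
  have "arccos a \<le> pi/2" using arccos_le_arccos[of 0 a] assms by simp
  moreover have "y \<le> arccos a \<longleftrightarrow> a \<le> cos y" if "0 \<le> y" "y \<le> pi/2"
  proof -
    have "arccos (cos y) = y" using that by (simp add: arccos_cos)
    then show ?thesis using arccos_le_mono[of "cos y" a] assms by simp
  qed
  ultimately show ?thesis using half_profile_cos[of y s] by auto
qed

definition coef :: "real \<Rightarrow> 3 \<Rightarrow> real" where
  "coef \<gamma> i = (if i = 3 then 1 else \<gamma>)"

definition profile_sum :: "real \<Rightarrow> real \<Rightarrow> real^3 \<Rightarrow> real" where
  "profile_sum s \<gamma> p = (\<Sum>i\<in>UNIV. coef \<gamma> i * profile s (p $ i))"

text \<open>A closed form for the reflected union of the seven pieces, as
  \<open>reflected_K_set\<close> shows. The box cuts off the far points where the periodic sine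
  makes the sum nonnegative again.\<close>

definition region :: "real \<Rightarrow> real \<Rightarrow> (real^3) set" where
  "region s \<gamma> = {p. (\<forall>i. \<bar>p $ i\<bar> \<le> pi/2 + s * (pi/2)) \<and> 0 \<le> profile_sum s \<gamma> p}"

lemma profile_sum_eq: "profile_sum s \<gamma> p = \<gamma> * half_profile s \<bar>p$1\<bar> + \<gamma> * half_profile s \<bar>p$2\<bar> + half_profile s \<bar>p$3\<bar>"
  by (simp add: profile_sum_def coef_def sum_3 profile_def)

lemma if_chain_eq:
  fixes v :: real
  assumes "A \<or> B \<or> C \<or> D \<or> E \<or> F \<or> G"
    and "A \<Longrightarrow> a = v" "B \<Longrightarrow> b = v" "C \<Longrightarrow> c = v" "D \<Longrightarrow> d = v" "E \<Longrightarrow> e = v" "F \<Longrightarrow> f = v" "G \<Longrightarrow> g = v"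
  shows "(if A then a else if B then b else if C then c else if D then d else if E then e
    else if F then f else if G then g else 0) = v"
  using assms by auto

section \<open>The seven pieces as one superlevel set\<close>

locale pucci_parameters =
  fixes \<omega> \<gamma> s :: real
  assumes sqrt_omega: "sqrt \<omega> = s" and s_ge: "2 \<le> s"
    and gamma_ge: "2 / s \<le> \<gamma>" and gamma_le: "\<gamma> \<le> s / 2"
begin

abbreviation P where "P \<equiv> half_profile s"
abbreviation T where "T \<equiv> pi/2 + s * (pi/2)"

lemma s_pos: "0 < s" using s_ge by linarith

lemma gamma_s_ge: "2 \<le> \<gamma> * s"
  using gamma_ge s_pos by (simp add: pos_divide_le_eq)

lemma gamma_pos: "0 < \<gamma>"
  using gamma_s_ge s_pos by (smt (verit) mult_nonpos_nonneg)

lemma half_pi_less_T: "pi/2 < T" using s_pos by simp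

text \<open>Half of \<open>\<gamma> * s\<close> dominates \<open>\<gamma>\<close> because
  \<open>s\<close> is at least 2, the other half dominates 1 because \<open>\<gamma> * s\<close> is
  at least 2. The bound keeps the arcsin arguments of [X] and [Y] at most 1 and makes
  \<open>u\<close> nonpositive where the first or second coordinate reaches
  \<open>T\<close>.\<close>

lemma gamma_add_one_le: "\<gamma> + 1 \<le> \<gamma> * s"
proof -
  have "2 * \<gamma> \<le> \<gamma> * s" using mult_left_mono[OF s_ge, of \<gamma>] gamma_pos by (simp add: mult.commute)
  then show ?thesis using gamma_s_ge by linarith
qed

lemma P_bounds:
  assumes "0 \<le> t" "t \<le> T"
  shows "P t \<le> 1" "- s \<le> P t"
  using half_profile_le_1 half_profile_ge s_pos assms by auto

lemma P_upper_nonpos: "pi/2 \<le> t \<Longrightarrow> t \<le> T \<Longrightarrow> P t \<le> 0"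
proof (cases "t = pi/2")
  case True
  show ?thesis unfolding True by (simp add: half_profile_cos)
next
  case False
  then show "pi/2 \<le> t \<Longrightarrow> t \<le> T \<Longrightarrow> P t \<le> 0" using half_profile_neg[OF s_pos, of t] by simp
qed

lemma cos_bounds: "0 \<le> t \<Longrightarrow> t \<le> pi/2 \<Longrightarrow> 0 \<le> cos t \<and> cos t \<le> 1"
  by (simp add: cos_ge_zero)

text \<open>This and the following characterisations have one shape: a choice for each coordinate
  between [0, pi/2] and [pi/2, \<open>T\<close>], together with nonnegativity of the same sum. Here
  2\<open>\<gamma>\<close> <= \<open>s\<close> keeps the arcsin argument at most 1.\<close>

lemma in_Z_iff: "in_Z \<omega> \<gamma> x y z \<longleftrightarrow> 0 \<le> x \<and> x \<le> pi/2 \<and> 0 \<le> y \<and> y \<le> pi/2 \<and> pi/2 \<le> z \<and> z \<le> T \<and>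
    0 \<le> \<gamma> * P x + \<gamma> * P y + P z"
proof (cases "0 \<le> x \<and> x \<le> pi/2 \<and> 0 \<le> y \<and> y \<le> pi/2")
  case True
  define a where "a = \<gamma> / s * (cos x + cos y)"
  have c: "0 \<le> cos x" "cos x \<le> 1" "0 \<le> cos y" "cos y \<le> 1" using True cos_bounds by auto
  have a: "0 \<le> a" using c gamma_pos s_pos by (simp add: a_def)
  have "cos x + cos y \<le> 2" using c by linarith
  then have "a \<le> \<gamma> / s * 2" unfolding a_def using gamma_pos s_pos by (intro mult_left_mono) auto
  also have "\<dots> \<le> 1" using gamma_le s_pos by (simp add: field_simps)
  finally have a1: "a \<le> 1" .
  have "s * a = \<gamma> * P x + \<gamma> * P y" using True s_pos by (simp add: a_def half_profile_cos distrib_left)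
  then show ?thesis
    using True le_arcsin_scaled_iff[OF s_pos a a1, of z] unfolding in_Z_def sqrt_omega a_def[symmetric] by auto
qed (auto simp: in_Z_def sqrt_omega)

lemma face_piece_iff:
  "x \<in> {pi/2..pi/2 + s * arcsin ((\<gamma> * cos y + cos z) / (\<gamma> * s))} \<longleftrightarrow>
    pi/2 \<le> x \<and> x \<le> T \<and> 0 \<le> \<gamma> * P x + \<gamma> * P y + P z"
  if yz: "0 \<le> y" "y \<le> pi/2" "0 \<le> z" "z \<le> pi/2"
proof -
  define a where "a = (\<gamma> * cos y + cos z) / (\<gamma> * s)"
  have c: "0 \<le> cos y" "cos y \<le> 1" "0 \<le> cos z" "cos z \<le> 1" using yz cos_bounds by auto
  have gs0: "0 < \<gamma> * s" using gamma_pos s_pos by simp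
  have a: "0 \<le> a" using c gamma_pos s_pos by (simp add: a_def)
  have "\<gamma> * cos y \<le> \<gamma> * 1" using c gamma_pos by (intro mult_left_mono) auto
  then have "\<gamma> * cos y + cos z \<le> \<gamma> * s" using c gamma_add_one_le by linarith
  then have a1: "a \<le> 1" using gs0 by (simp add: a_def)
  have "\<gamma> * (s * a) = \<gamma> * P y + P z" using yz gamma_pos s_pos by (simp add: a_def half_profile_cos)
  moreover have "- P x \<le> s * a \<longleftrightarrow> \<gamma> * (- P x) \<le> \<gamma> * (s * a)"
    using gamma_pos by (simp only: mult_le_cancel_left_pos)
  ultimately show ?thesis
    using le_arcsin_scaled_iff[OF s_pos a a1, of x] unfolding a_def[symmetric] by auto
qed

lemma in_X_iff: "in_X \<omega> \<gamma> x y z \<longleftrightarrow> pi/2 \<le> x \<and> x \<le> T \<and> 0 \<le> y \<and> y \<le> pi/2 \<and> 0 \<le> z \<and> z \<le> pi/2 \<and>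
    0 \<le> \<gamma> * P x + \<gamma> * P y + P z"
  using face_piece_iff[of y z x] by (auto simp: in_X_def sqrt_omega)

lemma in_Y_iff: "in_Y \<omega> \<gamma> x y z \<longleftrightarrow> 0 \<le> x \<and> x \<le> pi/2 \<and> pi/2 \<le> y \<and> y \<le> T \<and> 0 \<le> z \<and> z \<le> pi/2 \<and>
    0 \<le> \<gamma> * P x + \<gamma> * P y + P z"
  using face_piece_iff[of x z y] by (auto simp: in_Y_def sqrt_omega)

text \<open>Multiplied by \<open>\<gamma>\<close>, theta becomes -\<open>\<gamma>\<close>P(x) -
  P(z), a sum of nonnegative terms. So theta <= 1 already implies both arcsin bounds, and theta <=
  cos y implies theta <= 1; all constraints collapse to the sign of the sum. The lemma serves [ZX]
  and, with x and y exchanged, [YZ].\<close>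

lemma edge_piece_iff:
  "x \<in> {pi/2..pi/2 + s * arcsin (1 / s)} \<and> z \<in> {pi/2..pi/2 + s * arcsin (\<gamma> / s)} \<and>
     s * sin ((x - pi/2) / s) + s / \<gamma> * sin ((z - pi/2) / s) \<in> {0..1} \<and>
     y \<in> {0..arccos (s * sin ((x - pi/2) / s) + s / \<gamma> * sin ((z - pi/2) / s))} \<longleftrightarrow>
   pi/2 \<le> x \<and> x \<le> T \<and> 0 \<le> y \<and> y \<le> pi/2 \<and> pi/2 \<le> z \<and> z \<le> T \<and> 0 \<le> \<gamma> * P x + \<gamma> * P y + P z"
  (is "?L \<longleftrightarrow> ?R")
proof (cases "pi/2 \<le> x \<and> x \<le> T \<and> pi/2 \<le> z \<and> z \<le> T")
  case True
  define \<theta> where "\<theta> = s * sin ((x - pi/2) / s) + s / \<gamma> * sin ((z - pi/2) / s)"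
  have th: "\<gamma> * \<theta> = - \<gamma> * P x - P z"
    using True gamma_pos by (simp add: \<theta>_def half_profile_sin distrib_left)
  have nonpos: "P x \<le> 0" "P z \<le> 0" using True P_upper_nonpos by auto
  have "0 \<le> \<gamma> * (- P x)" using nonpos gamma_pos by (intro mult_nonneg_nonneg) auto
  then have "0 \<le> \<gamma> * \<theta>" unfolding th using nonpos by simp
  then have th0: "0 \<le> \<theta>" using gamma_pos by (simp add: zero_le_mult_iff)
  have x: "x \<in> {pi/2..pi/2 + s * arcsin (1 / s)} \<longleftrightarrow> - P x \<le> 1"
    using le_arcsin_scaled_iff[OF s_pos, of "1/s" x] s_ge s_pos True by auto
  have "\<gamma> / s \<le> 1" using gamma_le s_pos by (simp add: pos_divide_le_eq)
  then have z: "z \<in> {pi/2..pi/2 + s * arcsin (\<gamma> / s)} \<longleftrightarrow> - P z \<le> \<gamma>"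
    using le_arcsin_scaled_iff[OF s_pos, of "\<gamma>/s" z] gamma_pos s_pos True by auto
  have xz: "- P x \<le> 1 \<and> - P z \<le> \<gamma>" if "\<theta> \<le> 1"
  proof -
    have "\<gamma> * \<theta> \<le> \<gamma> * 1" using that gamma_pos by (intro mult_left_mono) auto
    then have le: "- \<gamma> * P x - P z \<le> \<gamma>" unfolding th by simp
    then have "\<gamma> * (- P x) \<le> \<gamma> * 1" using nonpos by simp
    then have "- P x \<le> 1" using gamma_pos by (simp only: mult_le_cancel_left_pos)
    moreover have "0 \<le> - \<gamma> * P x" using nonpos gamma_pos by (simp add: mult_le_0_iff)
    ultimately show ?thesis using le by linarith
  qed
  have y: "\<theta> \<le> P y \<longleftrightarrow> 0 \<le> \<gamma> * P x + \<gamma> * P y + P z"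
  proof -
    have "\<theta> \<le> P y \<longleftrightarrow> \<gamma> * \<theta> \<le> \<gamma> * P y" using gamma_pos by simp
    then show ?thesis unfolding th by auto
  qed
  have "?L \<longleftrightarrow> \<theta> \<le> 1 \<and> 0 \<le> y \<and> y \<le> arccos \<theta>"
    unfolding \<theta>_def[symmetric] x z using xz th0 by auto
  also have "\<dots> \<longleftrightarrow> \<theta> \<le> 1 \<and> 0 \<le> y \<and> y \<le> pi/2 \<and> \<theta> \<le> P y"
    using le_arccos_nonneg_iff[OF th0, of y s] by auto
  also have "\<dots> \<longleftrightarrow> 0 \<le> y \<and> y \<le> pi/2 \<and> \<theta> \<le> P y"
    using P_bounds(1)[of y] half_pi_less_T by auto
  also have "\<dots> \<longleftrightarrow> ?R" unfolding y using True by auto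
  finally show ?thesis .
next
  case False
  have 1: "pi/2 \<le> x \<and> x \<le> T" if "x \<in> {pi/2..pi/2 + s * arcsin (1 / s)}"
    using that le_arcsin_scaled_iff[OF s_pos, of "1/s" x] s_ge s_pos by auto
  have "\<gamma> / s \<le> 1" using gamma_le s_pos by (simp add: pos_divide_le_eq)
  then have 2: "pi/2 \<le> z \<and> z \<le> T" if "z \<in> {pi/2..pi/2 + s * arcsin (\<gamma> / s)}"
    using that le_arcsin_scaled_iff[OF s_pos, of "\<gamma>/s" z] gamma_pos s_pos by auto
  show ?thesis using False 1 2 by blast
qed

lemma in_ZX_iff: "in_ZX \<omega> \<gamma> x y z \<longleftrightarrow> pi/2 \<le> x \<and> x \<le> T \<and> 0 \<le> y \<and> y \<le> pi/2 \<and> pi/2 \<le> z \<and> z \<le> T \<and>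
    0 \<le> \<gamma> * P x + \<gamma> * P y + P z"
  using edge_piece_iff[of x z y] by (simp only: in_ZX_def sqrt_omega Let_def)

lemma in_YZ_iff: "in_YZ \<omega> \<gamma> x y z \<longleftrightarrow> 0 \<le> x \<and> x \<le> pi/2 \<and> pi/2 \<le> y \<and> y \<le> T \<and> pi/2 \<le> z \<and> z \<le> T \<and>
    0 \<le> \<gamma> * P x + \<gamma> * P y + P z"
  unfolding in_YZ_def sqrt_omega Let_def edge_piece_iff[of y z x] by (auto simp: add_ac)

lemma in_XY_iff: "in_XY \<omega> \<gamma> x y z \<longleftrightarrow> pi/2 \<le> x \<and> x \<le> T \<and> pi/2 \<le> y \<and> y \<le> T \<and> 0 \<le> z \<and> z \<le> pi/2 \<and>
    0 \<le> \<gamma> * P x + \<gamma> * P y + P z"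
  (is "?L \<longleftrightarrow> ?R")
proof (cases "pi/2 \<le> x \<and> x \<le> T \<and> pi/2 \<le> y \<and> y \<le> T")
  case True
  define \<theta> where "\<theta> = \<gamma> * s * sin ((x - pi/2) / s) + \<gamma> * s * sin ((y - pi/2) / s)"
  have th: "\<theta> = - \<gamma> * P x - \<gamma> * P y"
    using True by (simp add: \<theta>_def half_profile_sin)
  have nonneg: "0 \<le> - \<gamma> * P x" "0 \<le> - \<gamma> * P y"
    using True P_upper_nonpos gamma_pos by (auto simp: mult_le_0_iff)
  have th0: "0 \<le> \<theta>" unfolding th using nonneg by linarith
  have arc: "t \<in> {pi/2..pi/2 + s * arcsin (1 / (\<gamma> * s))} \<longleftrightarrow> - \<gamma> * P t \<le> 1" if "pi/2 \<le> t" "t \<le> T" for t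
  proof -
    have "1 / (\<gamma> * s) \<le> 1" "0 \<le> 1 / (\<gamma> * s)" using gamma_s_ge by auto
    from le_arcsin_scaled_iff[OF s_pos this(2,1), of t]
    have "t \<in> {pi/2..pi/2 + s * arcsin (1 / (\<gamma> * s))} \<longleftrightarrow> - P t \<le> 1 / \<gamma>" using that s_pos by auto
    also have "\<dots> \<longleftrightarrow> - \<gamma> * P t \<le> 1" using gamma_pos by (simp add: pos_le_divide_eq mult.commute)
    finally show ?thesis .
  qed
  have "?L \<longleftrightarrow> - \<gamma> * P x \<le> 1 \<and> - \<gamma> * P y \<le> 1 \<and> \<theta> \<le> 1 \<and> 0 \<le> z \<and> z \<le> arccos \<theta>"
    unfolding in_XY_def sqrt_omega Let_def \<theta>_def[symmetric] using arc True th0 by auto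
  also have "\<dots> \<longleftrightarrow> \<theta> \<le> 1 \<and> 0 \<le> z \<and> z \<le> pi/2 \<and> \<theta> \<le> P z"
    using le_arccos_nonneg_iff[OF th0, of z s] th nonneg by auto
  also have "\<dots> \<longleftrightarrow> 0 \<le> z \<and> z \<le> pi/2 \<and> \<theta> \<le> P z"
    using P_bounds(1)[of z] half_pi_less_T by auto
  also have "\<dots> \<longleftrightarrow> ?R" unfolding th using True by auto
  finally show ?thesis .
next
  case False
  have "1 / (\<gamma> * s) \<le> 1" "0 \<le> 1 / (\<gamma> * s)" using gamma_s_ge by auto
  then have "pi/2 \<le> t \<and> t \<le> T" if "t \<in> {pi/2..pi/2 + s * arcsin (1 / (\<gamma> * s))}" for t
    using that le_arcsin_scaled_iff[OF s_pos, of "1 / (\<gamma> * s)" t] by auto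
  then show ?thesis using False unfolding in_XY_def sqrt_omega by blast
qed

text \<open>On the cube the sum is automatically nonnegative; stating it gives [C] the same shape as
  the other six pieces.\<close>

lemma in_C_iff: "in_C x y z \<longleftrightarrow> 0 \<le> x \<and> x \<le> pi/2 \<and> 0 \<le> y \<and> y \<le> pi/2 \<and> 0 \<le> z \<and> z \<le> pi/2 \<and>
    0 \<le> \<gamma> * P x + \<gamma> * P y + P z"
  using gamma_pos by (auto simp: in_C_def intro!: add_nonneg_nonneg mult_nonneg_nonneg half_profile_nonneg)

lemmas in_piece_iffs = in_C_iff in_Z_iff in_X_iff in_Y_iff in_ZX_iff in_XY_iff in_YZ_iff

text \<open>Of the eight low/high patterns of the coordinates the seven pieces omit only the
  all-high one. If all three exceed pi/2, every summand is negative; if one equals pi/2, it also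
  counts as low, so the point lies in another piece.\<close>

lemma in_some_piece_iff:
  "in_C x y z \<or> in_Z \<omega> \<gamma> x y z \<or> in_X \<omega> \<gamma> x y z \<or> in_Y \<omega> \<gamma> x y z \<or>
     in_ZX \<omega> \<gamma> x y z \<or> in_XY \<omega> \<gamma> x y z \<or> in_YZ \<omega> \<gamma> x y z \<longleftrightarrow>
   0 \<le> x \<and> x \<le> T \<and> 0 \<le> y \<and> y \<le> T \<and> 0 \<le> z \<and> z \<le> T \<and> 0 \<le> \<gamma> * P x + \<gamma> * P y + P z"
proof -
  have "\<gamma> * P x + \<gamma> * P y + P z < 0" if "pi/2 < x" "x \<le> T" "pi/2 < y" "y \<le> T" "pi/2 < z" "z \<le> T"
    using half_profile_neg[OF s_pos] that gamma_pos by (intro add_neg_neg mult_pos_neg) auto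
  then have low: "x \<le> pi/2 \<or> y \<le> pi/2 \<or> z \<le> pi/2"
    if "x \<le> T" "y \<le> T" "z \<le> T" "0 \<le> \<gamma> * P x + \<gamma> * P y + P z"
    using that by (meson not_le)
  define lo where "lo t \<longleftrightarrow> 0 \<le> t \<and> t \<le> pi/2" for t
  define hi where "hi t \<longleftrightarrow> pi/2 \<le> t \<and> t \<le> T" for t
  define Q where "Q \<longleftrightarrow> 0 \<le> \<gamma> * P x + \<gamma> * P y + P z"
  have split: "0 \<le> t \<and> t \<le> T \<longleftrightarrow> lo t \<or> hi t" for t
    unfolding lo_def hi_def using half_pi_less_T pi_gt_zero by linarith
  have "lo x \<or> lo y \<or> lo z" if "hi x" "hi y" "hi z" "Q"
  proof -
    have "0 \<le> x" "0 \<le> y" "0 \<le> z" using that(1-3) pi_gt_zero unfolding hi_def by linarith+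
    moreover have "x \<le> pi/2 \<or> y \<le> pi/2 \<or> z \<le> pi/2"
      using that low unfolding hi_def Q_def by blast
    ultimately show ?thesis unfolding lo_def by blast
  qed
  moreover have "in_C x y z \<longleftrightarrow> lo x \<and> lo y \<and> lo z \<and> Q"
    "in_Z \<omega> \<gamma> x y z \<longleftrightarrow> lo x \<and> lo y \<and> hi z \<and> Q" "in_X \<omega> \<gamma> x y z \<longleftrightarrow> hi x \<and> lo y \<and> lo z \<and> Q"
    "in_Y \<omega> \<gamma> x y z \<longleftrightarrow> lo x \<and> hi y \<and> lo z \<and> Q" "in_ZX \<omega> \<gamma> x y z \<longleftrightarrow> hi x \<and> lo y \<and> hi z \<and> Q"
    "in_XY \<omega> \<gamma> x y z \<longleftrightarrow> hi x \<and> hi y \<and> lo z \<and> Q" "in_YZ \<omega> \<gamma> x y z \<longleftrightarrow> lo x \<and> hi y \<and> hi z \<and> Q"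
    unfolding in_piece_iffs lo_def hi_def Q_def by (simp_all only: conj_assoc)
  moreover have "0 \<le> x \<and> x \<le> T \<and> 0 \<le> y \<and> y \<le> T \<and> 0 \<le> z \<and> z \<le> T \<and> Q \<longleftrightarrow>
      (lo x \<or> hi x) \<and> (lo y \<or> hi y) \<and> (lo z \<or> hi z) \<and> Q"
    unfolding split[symmetric] by (simp only: conj_assoc)
  ultimately show ?thesis
    unfolding Q_def[symmetric] by metis
qed

lemma u_pos_eq:
  assumes "0 \<le> x" "x \<le> T" "0 \<le> y" "y \<le> T" "0 \<le> z" "z \<le> T" "0 \<le> \<gamma> * P x + \<gamma> * P y + P z"
  shows "u_pos \<omega> \<gamma> x y z = \<gamma> * P x + \<gamma> * P y + P z"
proof -
  have cs: "cos t = P t" if "t \<le> pi/2" for t using that by (simp add: half_profile_cos)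
  have sn: "- (s * sin ((t - pi/2) / s)) = P t" if "pi/2 \<le> t" for t using that by (simp add: half_profile_sin)
  have sn': "- \<gamma> * s * sin ((t - pi/2) / s) = \<gamma> * P t" if "pi/2 \<le> t" for t using that by (simp add: half_profile_sin)
  have "in_C x y z \<or> in_Z \<omega> \<gamma> x y z \<or> in_X \<omega> \<gamma> x y z \<or> in_Y \<omega> \<gamma> x y z \<or>
     in_ZX \<omega> \<gamma> x y z \<or> in_XY \<omega> \<gamma> x y z \<or> in_YZ \<omega> \<gamma> x y z"
    using in_some_piece_iff assms by blast
  moreover have "\<gamma> * cos x + \<gamma> * cos y + cos z = \<gamma> * P x + \<gamma> * P y + P z" if "in_C x y z"
    using that cs[of x] cs[of y] cs[of z] by (simp add: in_piece_iffs)
  moreover have "\<gamma> * cos x + \<gamma> * cos y - s * sin ((z - pi/2) / s) = \<gamma> * P x + \<gamma> * P y + P z" if "in_Z \<omega> \<gamma> x y z"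
    using that cs[of x] cs[of y] sn[of z] by (simp add: in_piece_iffs)
  moreover have "- \<gamma> * s * sin ((x - pi/2) / s) + \<gamma> * cos y + cos z = \<gamma> * P x + \<gamma> * P y + P z" if "in_X \<omega> \<gamma> x y z"
    using that sn'[of x] cs[of y] cs[of z] by (simp add: in_piece_iffs)
  moreover have "\<gamma> * cos x - \<gamma> * s * sin ((y - pi/2) / s) + cos z = \<gamma> * P x + \<gamma> * P y + P z" if "in_Y \<omega> \<gamma> x y z"
    using that sn'[of y] cs[of x] cs[of z] by (simp add: in_piece_iffs)
  moreover have "- \<gamma> * s * sin ((x - pi/2) / s) + \<gamma> * cos y - s * sin ((z - pi/2) / s) = \<gamma> * P x + \<gamma> * P y + P z"
    if "in_ZX \<omega> \<gamma> x y z"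
    using that sn'[of x] cs[of y] sn[of z] by (simp add: in_piece_iffs)
  moreover have "- \<gamma> * s * sin ((x - pi/2) / s) - \<gamma> * s * sin ((y - pi/2) / s) + cos z = \<gamma> * P x + \<gamma> * P y + P z"
    if "in_XY \<omega> \<gamma> x y z"
    using that sn'[of x] sn'[of y] cs[of z] by (simp add: in_piece_iffs)
  moreover have "\<gamma> * cos x - \<gamma> * s * sin ((y - pi/2) / s) - s * sin ((z - pi/2) / s) = \<gamma> * P x + \<gamma> * P y + P z"
    if "in_YZ \<omega> \<gamma> x y z"
    using that sn'[of y] cs[of x] sn[of z] by (simp add: in_piece_iffs)
  ultimately show ?thesis unfolding u_pos_def sqrt_omega by (rule if_chain_eq)
qed

lemma u_fun_eq: "p \<in> region s \<gamma> \<Longrightarrow> u_fun \<omega> \<gamma> p = profile_sum s \<gamma> p"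
  unfolding u_fun_def profile_sum_eq by (rule u_pos_eq) (auto simp: region_def profile_sum_eq)

lemma reflected_K_set: "{(\<chi> i. \<sigma> $ i * q $ i) | q \<sigma>. q \<in> K_set \<omega> \<gamma> \<and> (\<forall>i. \<sigma> $ i \<in> {-1, 1})} = region s \<gamma>"
  (is "?L = _")
proof -
  have K: "q \<in> K_set \<omega> \<gamma> \<longleftrightarrow> (\<forall>i. 0 \<le> q $ i) \<and> q \<in> region s \<gamma>" for q
    unfolding K_set_def mem_Collect_eq Let_def in_some_piece_iff region_def profile_sum_eq forall_3
    by (smt (verit) abs_of_nonneg)
  show ?thesis
  proof
    show "?L \<subseteq> region s \<gamma>"
    proof
      fix p assume "p \<in> ?L"
      then obtain q \<sigma> where p: "p = (\<chi> i. \<sigma> $ i * q $ i)" and q: "q \<in> K_set \<omega> \<gamma>"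
        and \<sigma>: "\<And>i. \<sigma> $ i \<in> {-1, 1}" by blast
      have "\<bar>p $ i\<bar> = \<bar>q $ i\<bar>" for i using \<sigma>[of i] by (auto simp: p)
      moreover have "q \<in> region s \<gamma>" using q K by blast
      ultimately show "p \<in> region s \<gamma>" by (simp add: region_def profile_sum_eq)
    qed
    show "region s \<gamma> \<subseteq> ?L"
    proof
      fix p assume p: "p \<in> region s \<gamma>"
      define q :: "real^3" where "q = (\<chi> i. \<bar>p $ i\<bar>)"
      \<comment> \<open>The value 1 is taken on coordinate planes, where \<open>sgn\<close> would
        give 0, which is not an admissible sign.\<close>
      define \<sigma> :: "real^3" where "\<sigma> = (\<chi> i. if p $ i < 0 then -1 else 1)"
      have "q \<in> K_set \<omega> \<gamma>" using p by (simp add: K q_def region_def profile_sum_eq)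
      moreover have "p = (\<chi> i. \<sigma> $ i * q $ i)" by (simp add: vec_eq_iff \<sigma>_def q_def)
      moreover have "\<forall>i. \<sigma> $ i \<in> {-1, 1}" by (simp add: \<sigma>_def)
      ultimately show "p \<in> ?L" by blast
    qed
  qed
qed

end

section \<open>The eigenfunction and the half-eigenvalue\<close>

definition profile_grad :: "real \<Rightarrow> real \<Rightarrow> real^3 \<Rightarrow> real^3" where
  "profile_grad s \<gamma> p = (\<chi> i. coef \<gamma> i * profile' s (p $ i))"

definition profile_hess :: "real \<Rightarrow> real \<Rightarrow> real^3 \<Rightarrow> real^3^3" where
  "profile_hess s \<gamma> p = (\<chi> i j. if i = j then coef \<gamma> i * profile'' s (p $ i) else 0)"

lemma profile_sum_C2:
  assumes "s > 0"
  shows "C2_on UNIV (profile_sum s \<gamma>) (profile_grad s \<gamma>) (profile_hess s \<gamma>)"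
  unfolding profile_sum_def[abs_def] profile_grad_def[abs_def] profile_hess_def[abs_def]
  using assms by (intro C2_on_separable profile_DERIV continuous_on_profile'')

lemma continuous_on_profile_sum:
  assumes "s > 0"
  shows "continuous_on A (profile_sum s \<gamma>)"
proof -
  have "continuous_on UNIV (profile_sum s \<gamma>)"
    by (rule has_derivative_continuous_on[OF has_derivative_at_withinI])
      (rule C2_on_D(1)[OF profile_sum_C2[OF assms] UNIV_I])
  then show ?thesis by (rule continuous_on_subset) simp
qed

lemma profile_hess_form:
  "h \<bullet> (profile_hess s \<gamma> p *v h) = (\<Sum>i\<in>UNIV. coef \<gamma> i * profile'' s (p $ i) * (h $ i)\<^sup>2)"
proof -
  have "(profile_hess s \<gamma> p *v h) $ i = coef \<gamma> i * profile'' s (p $ i) * h $ i" for i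
    by (simp add: profile_hess_def matrix_vector_mult_def if_distrib if_distribR cong: if_cong)
  then show ?thesis by (simp add: inner_vec_def power2_eq_square mult_ac)
qed

text \<open>The one-variable inequality behind the strict subsolution: \<open>v\<close> stands for
  the value of the eigenfunction at the contact point and \<open>G\<close> for its squared gradient.
  Above a threshold the surplus (mu - lambda r)v^r pays for the constant mu delta^r; below it the
  gradient term alone exceeds mu v^r.\<close>

lemma test_exponent:
  fixes lam \<mu> \<kappa> :: real
  assumes lam: "0 < lam" and mu: "lam < \<mu>" and \<kappa>: "0 < \<kappa>"
  obtains r \<delta> where "1 < r" "0 < \<delta>" "\<delta> < 1"
    and "\<And>v G. \<lbrakk>\<delta> < v; 0 \<le> G; v \<le> 1/2 \<Longrightarrow> \<kappa> * v \<le> G\<rbrakk> \<Longrightarrow>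
      0 < - lam * (r * v powr r) + lam * (r * (r - 1) * v powr (r - 2)) * G + \<mu> * (v powr r - \<delta> powr r)"
proof -
  \<comment> \<open>The midpoint of 1 and \<open>\<mu> / lam\<close>.\<close>
  define r where "r = (1 + \<mu> / lam) / 2"
  have r: "1 < r" using lam mu by (simp add: r_def)
  have "2 * (lam * r) = lam + \<mu>" using lam by (simp add: r_def distrib_left)
  then have lr: "lam * r < \<mu>" using mu by linarith
  have mu0: "0 < \<mu>" using lam mu by linarith
  define C where "C = lam * (r * (r - 1)) * \<kappa>"
  have C: "0 < C" using lam r \<kappa> by (simp add: C_def)
  \<comment> \<open>For v <= C/mu one has mu v^r <= C v^(r-1), which the gradient term dominates;
    the cap 1/2 is the range in which the bound on \<open>G\<close> is available.\<close>
  define v0 where "v0 = min (1/2) (C / \<mu>)"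
  have v0: "v0 \<le> 1/2" "v0 \<le> C / \<mu>" unfolding v0_def by (rule min.cobounded1, rule min.cobounded2)
  have v0_pos: "0 < v0" using C mu0 by (simp add: v0_def)
  \<comment> \<open>This will be \<open>\<delta> powr r\<close>. The second entry makes it
    affordable by the surplus at \<open>v0\<close>, the first forces
    \<open>\<delta> < 1\<close>.\<close>
  define \<epsilon> where "\<epsilon> = min (1/2) ((\<mu> - lam * r) * v0 powr r / \<mu>)"
  have e: "0 < \<epsilon>" "\<epsilon> < 1" using lr v0_pos mu0 by (simp_all add: \<epsilon>_def min_less_iff_disj)
  have "\<mu> * \<epsilon> \<le> \<mu> * ((\<mu> - lam * r) * v0 powr r / \<mu>)"
    unfolding \<epsilon>_def using mu0 by (intro mult_left_mono) auto
  then have e2: "\<mu> * \<epsilon> \<le> (\<mu> - lam * r) * v0 powr r" using mu0 by simp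
  define \<delta> where "\<delta> = \<epsilon> powr (1 / r)"
  have d: "0 < \<delta>" using e by (simp add: \<delta>_def)
  have dr: "\<delta> powr r = \<epsilon>" using e r by (simp add: \<delta>_def powr_powr)
  have "\<delta> < 1 powr (1 / r)" unfolding \<delta>_def using e r by (intro powr_less_mono2) auto
  then have d1: "\<delta> < 1" by simp
  have "0 < - lam * (r * v powr r) + lam * (r * (r - 1) * v powr (r - 2)) * G + \<mu> * (v powr r - \<delta> powr r)"
    if v: "\<delta> < v" and G: "0 \<le> G" "v \<le> 1/2 \<Longrightarrow> \<kappa> * v \<le> G" for v G
  proof -
    have vpos: "0 < v" using v d by linarith
    have ev: "\<epsilon> < v powr r" unfolding dr[symmetric] using v d r by (intro powr_less_mono2) auto
    have vr: "v powr r = v powr (r - 2) * v * v"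
    proof -
      have "v powr r = v powr (r - 2) * v powr 2" by (simp add: powr_add[symmetric])
      then show ?thesis using vpos by (simp add: power2_eq_square)
    qed
    let ?D = "lam * (r * (r - 1) * v powr (r - 2)) * G"
    have D0: "0 \<le> ?D" using lam r G by simp
    have main: "\<mu> * \<epsilon> < (\<mu> - lam * r) * v powr r + ?D"
    proof (cases "v \<le> v0")
      case True
      have "v \<le> C / \<mu>" using True v0(2) by (rule order_trans)
      then have "\<mu> * v \<le> C" using mu0 by (simp add: pos_le_divide_eq mult.commute)
      then have "(\<mu> * v) * (v powr (r - 2) * v) \<le> C * (v powr (r - 2) * v)"
        using vpos by (intro mult_right_mono) auto
      then have "\<mu> * v powr r \<le> lam * (r * (r - 1) * v powr (r - 2)) * (\<kappa> * v)"
        unfolding vr C_def by (simp add: mult_ac)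
      also have "\<dots> \<le> ?D"
        using True v0 G lam r by (intro mult_left_mono) auto
      finally have "\<mu> * v powr r \<le> ?D" .
      moreover have "\<mu> * \<epsilon> < \<mu> * v powr r" using ev mu0 by simp
      moreover have "0 \<le> (\<mu> - lam * r) * v powr r" using lr by simp
      ultimately show ?thesis by linarith
    next
      case False
      then have "v0 powr r < v powr r" using v0_pos r by (intro powr_less_mono2) auto
      then have "(\<mu> - lam * r) * v0 powr r < (\<mu> - lam * r) * v powr r" using lr by simp
      then show ?thesis using e2 D0 by linarith
    qed
    show ?thesis unfolding dr using main by (simp add: algebra_simps)
  qed
  then show ?thesis using that[OF r d d1] by blast
qed

section \<open>The domain, the eigenfunction and the bound on the half-eigenvalue\<close>

context pucci_parameters
begin

abbreviation U where "U \<equiv> profile_sum s \<gamma>"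

lemma coef_pos: "0 < coef \<gamma> i" using gamma_pos by (simp add: coef_def)

text \<open>At a coordinate equal to \<open>T\<close> the profile is -s. In the first two directions
  this contributes -\<open>\<gamma> * s\<close>, against at most \<open>\<gamma> + 1\<close> from
  the rest; in the third -s, against at most 2\<open>\<gamma>\<close>.\<close>

lemma U_nonpos_at_end:
  assumes "\<And>i. \<bar>p $ i\<bar> \<le> T" "\<bar>p $ i\<bar> = T"
  shows "U p \<le> 0"
proof -
  have P: "P \<bar>p $ i\<bar> \<le> 1" for i using P_bounds assms(1) by simp
  have gP: "\<gamma> * P \<bar>p $ i\<bar> \<le> \<gamma>" for i using mult_left_mono[OF P[of i], of \<gamma>] gamma_pos by simp
  have PT: "P T = - s" using half_profile_end s_pos by simp
  have "\<gamma> * P T = - (\<gamma> * s)" unfolding PT by simp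
  then show ?thesis
    using assms(2) P[of 3] gP[of 1] gP[of 2] gamma_add_one_le gamma_le PT exhaust_3[of i]
    by (auto simp: profile_sum_eq)
qed

lemma closed_region: "closed (region s \<gamma>)"
proof -
  have "region s \<gamma> = (\<Inter>i. {p. \<bar>p $ i\<bar> \<le> T}) \<inter> {p. 0 \<le> U p}"
    by (auto simp: region_def)
  moreover have "closed \<dots>"
    using continuous_on_profile_sum[OF s_pos]
    by (intro closed_Int closed_INT ballI closed_Collect_le continuous_intros) auto
  ultimately show ?thesis by simp
qed

lemma compact_region: "compact (region s \<gamma>)"
proof -
  have "bounded (region s \<gamma>)"
  proof (rule boundedI)
    fix p assume "p \<in> region s \<gamma>"
    then have "(\<Sum>i\<in>UNIV. \<bar>p $ i\<bar>) \<le> (\<Sum>i\<in>(UNIV::3 set). T)" by (intro sum_mono) (auto simp: region_def)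
    then show "norm p \<le> (\<Sum>i\<in>(UNIV::3 set). T)" using norm_le_l1_cart[of p] by linarith
  qed
  then show ?thesis using closed_region compact_eq_bounded_closed by blast
qed

lemma Omega_eq: "Omega \<omega> \<gamma> = {p. (\<forall>i. \<bar>p $ i\<bar> < T) \<and> 0 < U p}"
proof -
  let ?I = "{p. (\<forall>i. \<bar>p $ i\<bar> < T) \<and> 0 < U p}"
  have "interior (region s \<gamma>) = ?I"
  proof
    have "?I = (\<Inter>i. {p. \<bar>p $ i\<bar> < T}) \<inter> {p. 0 < U p}" by auto
    moreover have "open \<dots>"
      using continuous_on_profile_sum[OF s_pos]
      by (intro open_Int open_INT ballI open_Collect_less continuous_intros) auto
    ultimately have "open ?I" by simp
    then show "?I \<subseteq> interior (region s \<gamma>)"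
      by (rule interior_maximal[rotated]) (auto simp: region_def less_imp_le)
    show "interior (region s \<gamma>) \<subseteq> ?I"
    proof
      fix p assume "p \<in> interior (region s \<gamma>)"
      then obtain e where e: "e > 0" "ball p e \<subseteq> region s \<gamma>"
        using mem_interior by blast
      \<comment> \<open>All coordinates are pushed outwards, zero ones included. This strictly
        lowers every profile value, so \<open>0 <= U q\<close> makes \<open>U p\<close> positive and
        interior points cannot be zeros of \<open>U\<close>. Three shifts of e/4 keep
        \<open>q\<close> inside the ball.\<close>
      define q :: "real^3" where "q = (\<chi> i. p $ i + (e / 4) * (if p $ i < 0 then -1 else 1))"
      have aq: "\<bar>q $ i\<bar> = \<bar>p $ i\<bar> + e / 4" for i using e(1) by (auto simp: q_def)
      have "norm (p - q) \<le> (\<Sum>i\<in>UNIV. \<bar>(p - q) $ i\<bar>)" by (rule norm_le_l1_cart)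
      also have "\<dots> = (\<Sum>i\<in>(UNIV::3 set). e / 4)" using e(1) by (intro sum.cong) (auto simp: q_def)
      also have "\<dots> < e" using e(1) by simp
      finally have "q \<in> ball p e" by (simp add: dist_norm)
      then have q: "q \<in> region s \<gamma>" using e(2) by blast
      have qT: "\<bar>q $ i\<bar> \<le> T" for i using q by (simp add: region_def)
      have lt: "\<bar>p $ i\<bar> < T" for i using qT[of i] aq[of i] e(1) by linarith
      have less: "P \<bar>q $ i\<bar> < P \<bar>p $ i\<bar>" for i
        by (rule half_profile_strict_antimono[OF s_pos _ _ qT]) (use aq[of i] e(1) in simp_all)
      have "\<gamma> * P \<bar>q $ i\<bar> < \<gamma> * P \<bar>p $ i\<bar>" for i
        using less[of i] gamma_pos by (rule mult_strict_left_mono)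
      from this[of 1] this[of 2] less[of 3] have "U q < U p"
        unfolding profile_sum_eq by linarith
      then show "p \<in> ?I" using q lt by (auto simp: region_def)
    qed
  qed
  then show ?thesis unfolding Omega_def reflected_K_set .
qed

lemma open_Omega: "open (Omega \<omega> \<gamma>)" by (simp add: Omega_def)

lemma Omega_subset_region: "Omega \<omega> \<gamma> \<subseteq> region s \<gamma>"
  by (auto simp: Omega_eq region_def less_imp_le)

lemma region_pos_in_Omega:
  assumes "p \<in> region s \<gamma>" "0 < U p"
  shows "p \<in> Omega \<omega> \<gamma>"
proof -
  have "\<bar>p $ i\<bar> < T" for i
    using U_nonpos_at_end[of p i] assms by (force simp: region_def le_less)
  then show ?thesis using assms by (simp add: Omega_eq)
qed

lemma closure_Omega_subset: "closure (Omega \<omega> \<gamma>) \<subseteq> region s \<gamma>"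
  using Omega_subset_region closed_region by (rule closure_minimal)

text \<open>The classical equation for \<open>U\<close>: its Hessian is diagonal, and the left side
  is the Pucci operator on it.\<close>

lemma pucci_weight_sum:
  assumes "\<And>i. \<bar>p $ i\<bar> \<le> T" "Lam = s\<^sup>2 * lam"
  shows "(\<Sum>i\<in>UNIV. (if coef \<gamma> i * profile'' s (p $ i) > 0 then Lam else lam) * (coef \<gamma> i * profile'' s (p $ i)))
    = - (lam * U p)"
  unfolding profile_pucci_weight[OF s_pos coef_pos assms] profile_sum_def
  by (simp add: sum_negf sum_distrib_left)

lemma visc_super_u:
  assumes lam: "0 < lam" and Lam: "Lam = s\<^sup>2 * lam"
  shows "visc_super lam Lam lam (Omega \<omega> \<gamma>) (u_fun \<omega> \<gamma>)"
  unfolding visc_super_def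
proof (intro conjI allI ballI impI)
  show "continuous_on (Omega \<omega> \<gamma>) (u_fun \<omega> \<gamma>)"
    using continuous_on_profile_sum[OF s_pos] Omega_subset_region u_fun_eq
    by (subst continuous_on_cong[OF refl, of _ _ U]) auto
next
  fix V \<psi> g H x
  assume x: "x \<in> V" and V: "open V" "V \<subseteq> Omega \<omega> \<gamma>" and C2: "C2_on V \<psi> g H"
    and min: "\<forall>y\<in>V. u_fun \<omega> \<gamma> x - \<psi> x \<le> u_fun \<omega> \<gamma> y - \<psi> y"
  have u: "u_fun \<omega> \<gamma> y = U y" if "y \<in> V" for y using that V Omega_subset_region u_fun_eq by blast
  have D: "C2_on V (\<lambda>y. U y - \<psi> y) (\<lambda>y. profile_grad s \<gamma> y - g y) (\<lambda>y. profile_hess s \<gamma> y - H y)"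
    by (intro C2_on_diff C2 C2_on_subset[OF profile_sum_C2[OF s_pos]]) simp
  have "0 \<le> h \<bullet> ((profile_hess s \<gamma> x - H x) *v h)" for h
    by (rule C2_on_local_min_hessian[OF D V(1) x]) (use min x u in auto)
  then have le: "h \<bullet> (H x *v h) \<le> (\<Sum>i\<in>UNIV. coef \<gamma> i * profile'' s (x $ i) * (h $ i)\<^sup>2)" for h
    by (simp add: matrix_vector_mult_diff_rdistrib inner_diff_right profile_hess_form[symmetric])
  have "1 \<le> s\<^sup>2" using s_ge by (intro one_le_power) simp
  then have "lam \<le> Lam" using lam unfolding Lam by simp
  then have "pucci_sup lam Lam (H x) \<le>
      (\<Sum>i\<in>UNIV. (if coef \<gamma> i * profile'' s (x $ i) > 0 then Lam else lam) * (coef \<gamma> i * profile'' s (x $ i)))"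
    using lam le by (intro pucci_sup_le_diagonal C2_on_hessian_symmetric[OF C2 V(1) x]) auto
  also have "\<dots> = - (lam * U x)"
    using Omega_subset_region V(2) x Lam by (intro pucci_weight_sum) (auto simp: region_def)
  finally show "pucci_sup lam Lam (H x) + lam * u_fun \<omega> \<gamma> x \<le> 0" using u[OF x] by simp
qed

text \<open>With the weights \<open>A\<close> read off from the second derivatives of
  \<open>U\<close>, the lower bound for the Pucci operator involves the diagonal of
  \<open>H x\<close> alone, so the comparison of Hessians is tested on coordinate vectors.\<close>

lemma visc_sub_u:
  assumes lam: "0 < lam" and Lam: "Lam = s\<^sup>2 * lam"
  shows "visc_sub lam Lam lam (Omega \<omega> \<gamma>) (u_fun \<omega> \<gamma>)"
  unfolding visc_sub_def
proof (intro conjI allI ballI impI)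
  show "continuous_on (Omega \<omega> \<gamma>) (u_fun \<omega> \<gamma>)"
    using visc_super_u[OF assms] by (simp add: visc_super_def)
next
  fix V \<psi> g H x
  assume x: "x \<in> V" and V: "open V" "V \<subseteq> Omega \<omega> \<gamma>" and C2: "C2_on V \<psi> g H"
    and max: "\<forall>y\<in>V. u_fun \<omega> \<gamma> y - \<psi> y \<le> u_fun \<omega> \<gamma> x - \<psi> x"
  have u: "u_fun \<omega> \<gamma> y = U y" if "y \<in> V" for y using that V Omega_subset_region u_fun_eq by blast
  have D: "C2_on V (\<lambda>y. \<psi> y - U y) (\<lambda>y. g y - profile_grad s \<gamma> y) (\<lambda>y. H y - profile_hess s \<gamma> y)"
    by (intro C2_on_diff C2 C2_on_subset[OF profile_sum_C2[OF s_pos]]) simp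
  have nonneg: "0 \<le> h \<bullet> ((H x - profile_hess s \<gamma> x) *v h)" for h
    by (rule C2_on_local_min_hessian[OF D V(1) x]) (use max x u in force)
  have ge: "coef \<gamma> i * profile'' s (x $ i) \<le> H x $ i $ i" for i
    using nonneg[of "axis i 1"]
    by (simp add: matrix_vector_mult_basis inner_commute[of "axis i 1"] inner_axis column_def profile_hess_def)
  have "1 \<le> s\<^sup>2" using s_ge by (intro one_le_power) simp
  then have le: "lam \<le> Lam" using lam unfolding Lam by simp
  define A where "A i = (if coef \<gamma> i * profile'' s (x $ i) > 0 then Lam else lam)" for i
  have A: "lam \<le> A i \<and> A i \<le> Lam" for i using le by (simp add: A_def)
  have "- (lam * U x) = (\<Sum>i\<in>UNIV. A i * (coef \<gamma> i * profile'' s (x $ i)))"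
    unfolding A_def
    using Omega_subset_region V(2) x Lam by (intro pucci_weight_sum[symmetric]) (auto simp: region_def)
  also have "\<dots> \<le> (\<Sum>i\<in>UNIV. A i * H x $ i $ i)"
    using ge A lam by (intro sum_mono mult_left_mono) (auto intro: order_trans[OF less_imp_le])
  also have "\<dots> \<le> pucci_sup lam Lam (H x)"
    using A by (intro pucci_sup_ge_weighted_diag C2_on_hessian_symmetric[OF C2 V(1) x])
  finally show "0 \<le> pucci_sup lam Lam (H x) + lam * u_fun \<omega> \<gamma> x" using u[OF x] by simp
qed

lemma positive_eigenfunction_u:
  assumes lam: "0 < lam" and Lam: "Lam = s\<^sup>2 * lam"
  shows "positive_eigenfunction lam Lam lam (Omega \<omega> \<gamma>) (u_fun \<omega> \<gamma>)"
  unfolding positive_eigenfunction_def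
proof (intro conjI ballI visc_super_u visc_sub_u lam Lam)
  show "continuous_on (closure (Omega \<omega> \<gamma>)) (u_fun \<omega> \<gamma>)"
    using continuous_on_profile_sum[OF s_pos] closure_Omega_subset u_fun_eq
    by (subst continuous_on_cong[OF refl, of _ _ U]) auto
next
  fix p assume "p \<in> Omega \<omega> \<gamma>"
  then show "0 < u_fun \<omega> \<gamma> p"
    using u_fun_eq Omega_subset_region by (auto simp: Omega_eq)
next
  fix p assume "p \<in> frontier (Omega \<omega> \<gamma>)"
  then have "p \<in> region s \<gamma>" "p \<notin> Omega \<omega> \<gamma>"
    using closure_Omega_subset open_Omega by (auto simp: frontier_def interior_open)
  then show "u_fun \<omega> \<gamma> p = 0"
    using region_pos_in_Omega u_fun_eq by (force simp: region_def)
qed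

text \<open>If some profile value is nonpositive, \<open>U\<close> is at most a multiple of the
  height of that term above its minimum, which the squared slope in that coordinate controls
  linearly. Otherwise \<open>U p <= 1/2\<close> keeps the third coordinate away from the maximum of
  the profile. Some such cap is unavoidable, as the gradient vanishes at the origin.\<close>

lemma gradient_lower_bound:
  obtains \<kappa> where "0 < \<kappa>"
    "\<And>p. p \<in> Omega \<omega> \<gamma> \<Longrightarrow> U p \<le> 1/2 \<Longrightarrow> \<kappa> * U p \<le> (\<Sum>i\<in>UNIV. (profile_grad s \<gamma> p $ i)\<^sup>2)"
proof -
  \<comment> \<open>The entries \<open>1 / s\<close>, \<open>\<gamma> / s\<close> and 1 serve the
    third coordinate nonpositive, the first or second nonpositive, and all nonnegative,
    respectively.\<close>
  define \<kappa> where "\<kappa> = min (1 / s) (min (\<gamma> / s) 1)"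
  have k: "0 < \<kappa>" "\<kappa> \<le> 1 / s" "\<kappa> \<le> \<gamma> / s" "\<kappa> \<le> 1" using s_pos gamma_pos by (auto simp: \<kappa>_def)
  have "\<kappa> * U p \<le> (\<Sum>i\<in>UNIV. (profile_grad s \<gamma> p $ i)\<^sup>2)"
    if p: "p \<in> Omega \<omega> \<gamma>" "U p \<le> 1/2" for p
  proof -
    let ?Q = "\<lambda>i. half_profile' s \<bar>p $ i\<bar>"
    have Upos: "0 < U p" and range: "\<bar>p $ i\<bar> \<le> T" for i using p(1) by (auto simp: Omega_eq less_imp_le)
    have "(profile' s t)\<^sup>2 = (half_profile' s \<bar>t\<bar>)\<^sup>2" for t
      by (cases "t = 0") (auto simp: profile'_def half_profile'_def power_mult_distrib sgn_if)
    then have S: "(\<Sum>i\<in>UNIV. (profile_grad s \<gamma> p $ i)\<^sup>2) = \<gamma>\<^sup>2 * (?Q 1)\<^sup>2 + \<gamma>\<^sup>2 * (?Q 2)\<^sup>2 + (?Q 3)\<^sup>2"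
      by (simp add: profile_grad_def coef_def sum_3 power_mult_distrib)
    have P1: "P \<bar>p $ i\<bar> \<le> 1" for i using P_bounds range by simp
    have gP: "\<gamma> * P \<bar>p $ i\<bar> \<le> \<gamma>" for i using mult_left_mono[OF P1[of i], of \<gamma>] gamma_pos by simp
    have neg: "1 + P \<bar>p $ i\<bar> / s \<le> (?Q i)\<^sup>2" if "P \<bar>p $ i\<bar> \<le> 0" for i
      using half_profile'_square_ge(1)[OF s_pos _ range that] by simp
    have U_eq: "U p = \<gamma> * P \<bar>p $ 1\<bar> + \<gamma> * P \<bar>p $ 2\<bar> + P \<bar>p $ 3\<bar>" by (rule profile_sum_eq)
    have nn: "0 \<le> \<gamma>\<^sup>2 * (?Q i)\<^sup>2" "0 \<le> (?Q i)\<^sup>2" for i by simp_all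
    have side: "\<kappa> * U p \<le> \<gamma>\<^sup>2 * (?Q i)\<^sup>2"
      if i: "P \<bar>p $ i\<bar> \<le> 0" and Ule: "U p \<le> \<gamma> * P \<bar>p $ i\<bar> + \<gamma> + 1" for i
    proof -
      have "U p \<le> \<gamma> * P \<bar>p $ i\<bar> + \<gamma> * s" using Ule gamma_add_one_le by linarith
      also have "\<dots> = \<gamma> * s * (1 + P \<bar>p $ i\<bar> / s)" using s_pos by (simp add: field_simps)
      also have "\<dots> \<le> \<gamma> * s * (?Q i)\<^sup>2" using neg[OF i] gamma_pos s_pos by (intro mult_left_mono) auto
      finally have "\<gamma> / s * U p \<le> \<gamma> / s * (\<gamma> * s * (?Q i)\<^sup>2)"
        using gamma_pos s_pos by (intro mult_left_mono) auto
      also have "\<dots> = \<gamma>\<^sup>2 * (?Q i)\<^sup>2" using s_pos by (simp add: power2_eq_square)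
      finally show ?thesis using mult_right_mono[OF k(3), of "U p"] Upos by linarith
    qed
    consider "P \<bar>p $ 1\<bar> \<le> 0" | "P \<bar>p $ 2\<bar> \<le> 0" | "P \<bar>p $ 3\<bar> \<le> 0"
      | "0 \<le> P \<bar>p $ 1\<bar>" "0 \<le> P \<bar>p $ 2\<bar>" "0 \<le> P \<bar>p $ 3\<bar>" by linarith
    then show ?thesis
    proof cases
      case 1
      show ?thesis unfolding S using side[OF 1] gP[of 2] P1[of 3] U_eq nn[of 2] nn[of 3] by linarith
    next
      case 2
      show ?thesis unfolding S using side[OF 2] gP[of 1] P1[of 3] U_eq nn[of 1] nn[of 3] by linarith
    next
      case 3
      have "U p \<le> P \<bar>p $ 3\<bar> + s" using U_eq gP[of 1] gP[of 2] gamma_le by linarith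
      also have "\<dots> = s * (1 + P \<bar>p $ 3\<bar> / s)" using s_pos by (simp add: field_simps)
      also have "\<dots> \<le> s * (?Q 3)\<^sup>2" using neg[OF 3] s_pos by (intro mult_left_mono) auto
      finally have "1 / s * U p \<le> 1 / s * (s * (?Q 3)\<^sup>2)" using s_pos by (intro mult_left_mono) auto
      also have "\<dots> = (?Q 3)\<^sup>2" using s_pos by simp
      finally have "\<kappa> * U p \<le> (?Q 3)\<^sup>2" using mult_right_mono[OF k(2), of "U p"] Upos by linarith
      then show ?thesis unfolding S using nn[of 1] nn[of 2] by linarith
    next
      case 4
      have "0 \<le> \<gamma> * P \<bar>p $ 1\<bar>" "0 \<le> \<gamma> * P \<bar>p $ 2\<bar>" using 4 gamma_pos by simp_all
      \<comment> \<open>Hence the squared slope in the third direction is at least 1/2, which bounds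
        \<open>U p\<close> and so \<open>\<kappa> * U p\<close>.\<close>
      then have "P \<bar>p $ 3\<bar> \<le> 1/2" using U_eq p(2) by linarith
      moreover have "1 - P \<bar>p $ 3\<bar> \<le> (?Q 3)\<^sup>2"
        using half_profile'_square_ge(2)[OF s_pos _ range 4(3)] by simp
      moreover have "\<kappa> * U p \<le> 1 * U p" using k Upos by (intro mult_right_mono) auto
      ultimately show ?thesis unfolding S using p(2) nn(1)[of 1] nn(1)[of 2] by linarith
    qed
  qed
  then show ?thesis using that k(1) by blast
qed

text \<open>On the compact set \<open>S\<close>, which lies inside the domain, the quotient
  \<open>q\<close> has a maximum \<open>M\<close>. Dividing the numerator by \<open>M\<close> gives
  a test function touching \<open>\<phi>\<close> from below, and the supersolution inequality there
  contradicts \<open>test_exponent\<close>.\<close>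

lemma visc_super_eigenvalue_le:
  assumes lam: "0 < lam" and Lam: "Lam = s\<^sup>2 * lam"
    and pos: "\<And>x. x \<in> Omega \<omega> \<gamma> \<Longrightarrow> 0 < \<phi> x" and super: "visc_super lam Lam \<mu> (Omega \<omega> \<gamma>) \<phi>"
  shows "\<mu> \<le> lam"
proof (rule ccontr)
  assume "\<not> ?thesis"
  then have mu: "lam < \<mu>" by simp
  obtain \<kappa> where \<kappa>: "0 < \<kappa>"
    and grad: "\<And>p. p \<in> Omega \<omega> \<gamma> \<Longrightarrow> U p \<le> 1/2 \<Longrightarrow> \<kappa> * U p \<le> (\<Sum>i\<in>UNIV. (profile_grad s \<gamma> p $ i)\<^sup>2)"
    using gradient_lower_bound by blast
  obtain r \<delta> where r: "1 < r" and \<delta>: "0 < \<delta>" "\<delta> < 1"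
    and pos_test: "\<And>v G. \<lbrakk>\<delta> < v; 0 \<le> G; v \<le> 1/2 \<Longrightarrow> \<kappa> * v \<le> G\<rbrakk> \<Longrightarrow>
      0 < - lam * (r * v powr r) + lam * (r * (r - 1) * v powr (r - 2)) * G + \<mu> * (v powr r - \<delta> powr r)"
    using test_exponent[OF lam mu \<kappa>] by blast
  define S where "S = {p \<in> region s \<gamma>. \<delta> \<le> U p}"
  have S_Omega: "S \<subseteq> Omega \<omega> \<gamma>"
    using \<delta>(1) by (auto simp: S_def intro: region_pos_in_Omega)
  have "compact S"
  proof -
    have "S = region s \<gamma> \<inter> {p. \<delta> \<le> U p}" by (auto simp: S_def)
    moreover have "closed {p. \<delta> \<le> U p}"
      using continuous_on_profile_sum[OF s_pos] by (intro closed_Collect_le continuous_intros) auto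
    ultimately show ?thesis using compact_region by (simp add: compact_Int_closed)
  qed
  have "U 0 = 2 * \<gamma> + 1" by (simp add: profile_sum_eq half_profile_cos)
  then have U0: "\<delta> < U 0" using \<delta> gamma_pos by simp
  have zero: "0 \<in> S"
    using U0 \<delta>(1) half_pi_less_T pi_gt_zero by (auto simp: S_def region_def)
  define q where "q p = (U p powr r - \<delta> powr r) / \<phi> p" for p
  have "continuous_on S \<phi>"
    using super S_Omega by (auto simp: visc_super_def intro: continuous_on_subset)
  then have "continuous_on S q"
    unfolding q_def using \<delta>(1) pos S_Omega
    by (intro continuous_intros continuous_on_profile_sum[OF s_pos]) (force simp: S_def)+
  then obtain x where x: "x \<in> S" and max: "\<And>y. y \<in> S \<Longrightarrow> q y \<le> q x"
    using continuous_attains_sup[OF \<open>compact S\<close>, of q] zero by blast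
  define M where "M = q x"
  have "0 < q 0"
    unfolding q_def using U0 \<delta> r zero S_Omega pos[of 0] by (auto intro!: divide_pos_pos powr_less_mono2)
  then have M: "0 < M" using max[OF zero] by (simp add: M_def)
  have phix: "0 < \<phi> x" using pos x S_Omega by blast
  have Mphi: "M * \<phi> x = U x powr r - \<delta> powr r" using phix by (simp add: M_def q_def)
  define V where "V = {p \<in> Omega \<omega> \<gamma>. \<delta> < U p}"
  have VS: "V \<subseteq> S" using Omega_subset_region by (auto simp: V_def S_def)
  have V: "open V"
  proof -
    have "V = Omega \<omega> \<gamma> \<inter> {p. \<delta> < U p}" by (auto simp: V_def)
    moreover have "open {p. \<delta> < U p}"
      using continuous_on_profile_sum[OF s_pos] by (intro open_Collect_less continuous_intros) auto
    ultimately show ?thesis using open_Omega by auto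
  qed
  \<comment> \<open>A positive maximum excludes the level \<open>\<delta>\<close>, where the
    numerator of \<open>q\<close> vanishes; so the contact point lies in the open set
    \<open>V\<close>, as a viscosity test requires.\<close>
  have "U x \<noteq> \<delta>" using Mphi M phix by auto
  then have xV: "x \<in> V" using x S_Omega by (auto simp: V_def S_def)
  define \<psi> where "\<psi> p = (U p powr r - \<delta> powr r) / M" for p
  define G' where "G' v = r * v powr (r - 1) / M" for v
  define G'' where "G'' v = r * (r - 1) * v powr (r - 2) / M" for v
  define H where "H p = (\<chi> i j. G' (U p) * profile_hess s \<gamma> p $ i $ j
    + G'' (U p) * (profile_grad s \<gamma> p $ i * profile_grad s \<gamma> p $ j))" for p
  have C2: "C2_on V \<psi> (\<lambda>p. G' (U p) *\<^sub>R profile_grad s \<gamma> p) H"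
    unfolding \<psi>_def[abs_def] H_def[abs_def]
  proof (rule C2_on_compose[where G = "\<lambda>v. (v powr r - \<delta> powr r) / M"])
    show "C2_on V U (profile_grad s \<gamma>) (profile_hess s \<gamma>)"
      by (rule C2_on_subset[OF profile_sum_C2[OF s_pos]]) simp
    fix p assume "p \<in> V"
    then have Up: "0 < U p" using \<delta> by (simp add: V_def)
    show "((\<lambda>v. (v powr r - \<delta> powr r) / M) has_real_derivative G' (U p)) (at (U p))"
      unfolding G'_def using Up M by (auto intro!: derivative_eq_intros)
    show "(G' has_real_derivative G'' (U p)) (at (U p))"
      unfolding G'_def[abs_def] G''_def using Up M by (auto intro!: derivative_eq_intros simp: divide_simps) (simp_all add: algebra_simps)?
  next
    show "continuous_on (U ` V) G''"
      unfolding G''_def[abs_def] using \<delta> M by (intro continuous_intros) (auto simp: V_def)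
  qed
  have "\<phi> x - \<psi> x \<le> \<phi> y - \<psi> y" if "y \<in> V" for y
  proof -
    have "q y \<le> M" "0 < \<phi> y" using max that VS S_Omega pos unfolding M_def by blast+
    then have "U y powr r - \<delta> powr r \<le> M * \<phi> y" by (simp add: q_def pos_divide_le_eq)
    then have "\<psi> y \<le> \<phi> y" using M by (simp add: \<psi>_def pos_divide_le_eq mult.commute)
    moreover have "\<psi> x = \<phi> x" using M by (simp add: \<psi>_def Mphi[symmetric])
    ultimately show ?thesis by simp
  qed
  then have le0: "pucci_sup lam Lam (H x) + \<mu> * \<phi> x \<le> 0"
    using super xV V C2 unfolding visc_super_def V_def by (metis (no_types, lifting) mem_Collect_eq subsetI)
  have range: "\<bar>x $ i\<bar> \<le> T" for i using x by (simp add: S_def region_def)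
  define v where "v = U x"
  define G where "G = (\<Sum>i\<in>UNIV. (profile_grad s \<gamma> x $ i)\<^sup>2)"
  have v: "\<delta> < v" "0 < v" using xV \<delta> by (auto simp: V_def v_def)
  have "1 \<le> s\<^sup>2" using s_ge by (intro one_le_power) simp
  then have lamLam: "lam \<le> Lam" using lam unfolding Lam by simp
  \<comment> \<open>The weights belong to the Hessian of \<open>U\<close>, not to that of
    \<open>\<psi>\<close>: they turn the first part of \<open>H x\<close> into -lambda U exactly,
    while the rank-one part gains at least the factor \<open>lam\<close>.\<close>
  define A where "A i = (if coef \<gamma> i * profile'' s (x $ i) > 0 then Lam else lam)" for i
  have A: "lam \<le> A i \<and> A i \<le> Lam" for i using lamLam by (simp add: A_def)
  have G''0: "0 \<le> G'' v" using r M by (simp add: G''_def)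
  have hess: "(\<Sum>i\<in>UNIV. A i * (coef \<gamma> i * profile'' s (x $ i))) = - (lam * v)"
    unfolding A_def v_def using range Lam by (rule pucci_weight_sum)
  have "G' v * (- (lam * v)) + G'' v * (lam * G) \<le>
      G' v * (- (lam * v)) + G'' v * (\<Sum>i\<in>UNIV. A i * (profile_grad s \<gamma> x $ i)\<^sup>2)"
    unfolding G_def sum_distrib_left[of lam] using A G''0
    by (intro add_left_mono mult_left_mono sum_mono mult_right_mono) auto
  also have "\<dots> = (\<Sum>i\<in>UNIV. A i * H x $ i $ i)"
    unfolding hess[symmetric] sum_distrib_left sum.distrib[symmetric]
    by (rule sum.cong) (simp_all add: H_def profile_hess_def v_def power2_eq_square algebra_simps)
  also have "\<dots> \<le> pucci_sup lam Lam (H x)"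
    using A by (intro pucci_sup_ge_weighted_diag C2_on_hessian_symmetric[OF C2 V xV])
  finally have "G' v * (- (lam * v)) + G'' v * (lam * G) + \<mu> * \<phi> x \<le> 0" using le0 by linarith
  \<comment> \<open>Multiplying by \<open>M\<close> clears it from \<open>G'\<close> and
    \<open>G''\<close> and turns \<open>\<phi> x\<close> into U^r - delta^r.\<close>
  then have "M * (G' v * (- (lam * v)) + G'' v * (lam * G) + \<mu> * \<phi> x) \<le> 0"
    using M by (simp add: mult_le_0_iff)
  moreover have "M * (G' v * (- (lam * v)) + G'' v * (lam * G) + \<mu> * \<phi> x) =
      - lam * (r * v powr r) + lam * (r * (r - 1) * v powr (r - 2)) * G + \<mu> * (v powr r - \<delta> powr r)"
  proof -
    have "v powr r = v powr (r - 1) * v"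
      using powr_add[of v "r - 1" 1] v by simp
    then have "M * (G' v * (- (lam * v))) = - lam * (r * v powr r)" using M by (simp add: G'_def)
    moreover have "M * (G'' v * (lam * G)) = lam * (r * (r - 1) * v powr (r - 2)) * G"
      using M by (simp add: G''_def)
    moreover have "M * (\<mu> * \<phi> x) = \<mu> * (v powr r - \<delta> powr r)"
      using Mphi by (simp add: v_def mult.left_commute)
    ultimately show ?thesis by (simp only: distrib_left)
  qed
  moreover have "0 < - lam * (r * v powr r) + lam * (r * (r - 1) * v powr (r - 2)) * G + \<mu> * (v powr r - \<delta> powr r)"
    using grad[of x] xV v by (intro pos_test) (auto simp: G_def v_def V_def intro: sum_nonneg)
  ultimately show False by linarith
qed

end

theorem theorem4p9:
  fixes lam Lam \<omega> \<gamma> :: real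
  assumes "0 < lam" and "lam \<le> Lam"
    and "\<omega> = Lam / lam" and "\<omega> \<ge> 4"
    and "\<gamma> \<in> {2 / sqrt \<omega> .. sqrt \<omega> / 2}"
  shows "positive_eigenfunction lam Lam lam (Omega \<omega> \<gamma>) (u_fun \<omega> \<gamma>) \<and>
         half_eigenvalue_pos lam Lam (Omega \<omega> \<gamma>) = ereal lam"
proof -
  have "2 \<le> sqrt \<omega>" using real_sqrt_le_mono[OF assms(4)] by simp
  then interpret pucci_parameters \<omega> \<gamma> "sqrt \<omega>"
    using assms(5) by unfold_locales auto
  have Lam: "Lam = (sqrt \<omega>)\<^sup>2 * lam" using assms(1,3,4) by simp
  note eig = positive_eigenfunction_u[OF assms(1) Lam]
  have "half_eigenvalue_pos lam Lam (Omega \<omega> \<gamma>) = ereal lam"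
    unfolding half_eigenvalue_pos_def
  proof (rule antisym)
    show "(SUP \<mu>\<in>{\<mu>. \<exists>\<phi>. (\<forall>x\<in>Omega \<omega> \<gamma>. 0 < \<phi> x) \<and> visc_super lam Lam \<mu> (Omega \<omega> \<gamma>) \<phi>}. ereal \<mu>) \<le> ereal lam"
      using visc_super_eigenvalue_le[OF assms(1) Lam] by (intro SUP_least) auto
    \<comment> \<open>The eigenfunction itself is an admissible competitor with mu =
      \<open>lam\<close>.\<close>
    show "ereal lam \<le> (SUP \<mu>\<in>{\<mu>. \<exists>\<phi>. (\<forall>x\<in>Omega \<omega> \<gamma>. 0 < \<phi> x) \<and> visc_super lam Lam \<mu> (Omega \<omega> \<gamma>) \<phi>}. ereal \<mu>)"
      using eig unfolding positive_eigenfunction_def by (intro SUP_upper) auto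
  qed
  with eig show ?thesis by blast
qed

end
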